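(* Let $A$ and $B$ be positive commuting operators on a Hilbert space $H$ such that $A,A^{-1},B,B^{-1}$ are bounded, let $d\mu(t)=\frac{dt}{\pi\sqrt{t(1-t)}}$ on $[0,1]$, and let $y\in H$. Then $$((AB)^{1/2}y,y)=\inf\int_0^1\frac{(Af(t),f(t))}t\,d\mu(t)+\int_0^1\frac{(Bg(t),g(t))}{1-t}\,d\mu(t),$$ where the infimum is taken over all pairs $(f,g)$ of $H$-valued measurable functions on $[0,1]$ satisfying $\frac{Af(t)}t=\frac{Bg(t)}{1-t}$ $\mu$-a.e. and $$B^{1/2}y=\int_0^1\frac{A^{1/2}f(t)}t\,d\mu(t).$$ *)

theory Defs
  imports "HOL-Analysis.Analysis"
begin

text \<open>Complex Hilbert spaces, not assumed separable. The complex inner product is linear in the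
  first argument; its real part is the \<^const>\<open>inner\<close> of \<^class>\<open>real_inner\<close>, which fixes norm and
  topology.\<close>

class complex_hilbert_space = real_inner + complete_space +
  fixes scaleC :: "complex \<Rightarrow> 'a \<Rightarrow> 'a"  (infixr \<open>*\<^sub>C\<close> 75)
    and cinner :: "'a \<Rightarrow> 'a \<Rightarrow> complex"
  assumes scaleC_add_right: "c *\<^sub>C (x + y) = c *\<^sub>C x + c *\<^sub>C y"
    and scaleC_add_left: "(c + d) *\<^sub>C x = c *\<^sub>C x + d *\<^sub>C x"
    and scaleC_scaleC: "c *\<^sub>C d *\<^sub>C x = (c * d) *\<^sub>C x"
    and scaleR_scaleC: "r *\<^sub>R x = complex_of_real r *\<^sub>C x"
    and cinner_commute: "cinner x y = cnj (cinner y x)"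
    and cinner_add_left: "cinner (x + y) z = cinner x z + cinner y z"
    and cinner_scaleC_left: "cinner (c *\<^sub>C x) y = c * cinner x y"
    and inner_eq_Re_cinner: "inner x y = Re (cinner x y)"

instantiation complex :: complex_hilbert_space
begin

definition "c *\<^sub>C x = c * (x :: complex)"
definition "cinner x y = x * cnj (y :: complex)"

instance
  by standard
    (auto simp: scaleC_complex_def cinner_complex_def algebra_simps scaleR_conv_of_real
      inner_complex_def)

end

definition bounded_clinear :: "('h::complex_hilbert_space \<Rightarrow> 'h) \<Rightarrow> bool" where
  "bounded_clinear T \<longleftrightarrow> bounded_linear T \<and> (\<forall>c x. T (c *\<^sub>C x) = c *\<^sub>C T x)"

definition positive_op :: "('h::complex_hilbert_space \<Rightarrow> 'h) \<Rightarrow> bool" where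
  "positive_op T \<longleftrightarrow> bounded_clinear T \<and> (\<forall>x. cinner (T x) x \<in> \<real>\<^sub>\<ge>\<^sub>0)"

text \<open>The positive square root; meaningful when \<open>T\<close> is positive.\<close>

definition op_sqrt :: "('h::complex_hilbert_space \<Rightarrow> 'h) \<Rightarrow> 'h \<Rightarrow> 'h" where
  "op_sqrt T = (THE S. positive_op S \<and> S \<circ> S = T)"

text \<open>The library's Bochner integral requires a second countable target. The following are its
  notions of measurability and integral, without that restriction; the two lemmas show that
  they agree with the library's where both make sense.\<close>

definition strongly_measurable :: "'a measure \<Rightarrow> ('a \<Rightarrow> 'b::topological_space) \<Rightarrow> bool" where
  "strongly_measurable M f \<longleftrightarrow>
    (\<exists>s. (\<forall>i::nat. simple_function M (s i)) \<and> (\<forall>x\<in>space M. (\<lambda>i. s i x) \<longlonglongrightarrow> f x))"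

definition has_strong_integral :: "'a measure \<Rightarrow> ('a \<Rightarrow> 'b::real_normed_vector) \<Rightarrow> 'b \<Rightarrow> bool"
  where
  "has_strong_integral M f v \<longleftrightarrow>
    strongly_measurable M f \<and>
    (\<exists>s. (\<forall>i::nat. Bochner_Integration.simple_bochner_integrable M (s i)) \<and>
      (\<lambda>i. \<integral>\<^sup>+x. ennreal (norm (f x - s i x)) \<partial>M) \<longlonglongrightarrow> 0 \<and>
      (\<lambda>i. Bochner_Integration.simple_bochner_integral M (s i)) \<longlonglongrightarrow> v)"

lemma strongly_measurable_iff_borel_measurable:
  fixes f :: "'a \<Rightarrow> 'b::{metric_space, second_countable_topology}"
  shows "strongly_measurable M f \<longleftrightarrow> f \<in> borel_measurable M"
proof
  assume "strongly_measurable M f"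
  then show "f \<in> borel_measurable M"
    unfolding strongly_measurable_def
    by (blast intro: borel_measurable_LIMSEQ_metric borel_measurable_simple_function)
next
  assume "f \<in> borel_measurable M"
  from borel_measurable_implies_sequence_metric[OF this]
  show "strongly_measurable M f"
    unfolding strongly_measurable_def by blast
qed

lemma has_strong_integral_iff_has_bochner_integral:
  fixes f :: "'a \<Rightarrow> 'b::{real_normed_vector, second_countable_topology}"
  shows "has_strong_integral M f v \<longleftrightarrow> has_bochner_integral M f v"
  unfolding has_strong_integral_def has_bochner_integral.simps
    strongly_measurable_iff_borel_measurable
  by blast

definition arcsine_measure :: "real measure" where
  "arcsine_measure =
    density (restrict_space lborel {0..1}) (\<lambda>t. ennreal (1 / (pi * sqrt (t * (1 - t)))))"

text \<open>The quadratic forms below are real and nonnegative for positive \<open>A\<close> and \<open>B\<close>, so taking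
  \<^const>\<open>Re\<close> loses nothing; the integrals take values in \<open>[0, \<infinity>]\<close>.\<close>

definition energy ::
  "('h::complex_hilbert_space \<Rightarrow> 'h) \<Rightarrow> ('h \<Rightarrow> 'h) \<Rightarrow> (real \<Rightarrow> 'h) \<Rightarrow> (real \<Rightarrow> 'h) \<Rightarrow> ennreal"
  where
  "energy A B f g =
    (\<integral>\<^sup>+t. ennreal (Re (cinner (A (f t)) (f t)) / t) \<partial>arcsine_measure) +
    (\<integral>\<^sup>+t. ennreal (Re (cinner (B (g t)) (g t)) / (1 - t)) \<partial>arcsine_measure)"

definition admissible ::
  "('h::complex_hilbert_space \<Rightarrow> 'h) \<Rightarrow> ('h \<Rightarrow> 'h) \<Rightarrow> 'h \<Rightarrow> ((real \<Rightarrow> 'h) \<times> (real \<Rightarrow> 'h)) set"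
  where
  "admissible A B y = {(f, g).
    strongly_measurable arcsine_measure f \<and>
    strongly_measurable arcsine_measure g \<and>
    (AE t in arcsine_measure. A (f t) /\<^sub>R t = B (g t) /\<^sub>R (1 - t)) \<and>
    has_strong_integral arcsine_measure (\<lambda>t. op_sqrt A (f t) /\<^sub>R t) (op_sqrt B y)}"

end

theory Submission
  imports Defs
begin

text \<open>Put \<open>X = A\<^sup>-\<^sup>1\<close>, \<open>Y = B\<^sup>-\<^sup>1\<close> and \<open>M t = t X + (1 - t) Y\<close>. For an admissible pair write
  \<open>h t = A (f t) / t = B (g t) / (1 - t)\<close>; the energy becomes \<open>\<integral> (M h, h) d\<mu>\<close> and the constraint becomes
  \<open>\<integral> h d\<mu> = R y\<close> with \<open>R = (AB)\<^sup>1\<^sup>/\<^sup>2\<close>. The minimiser is \<open>w t = M t\<^sup>-\<^sup>1 y\<close>: expanding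
  \<open>0 \<le> (M (h - w), h - w)\<close> and integrating gives the lower bound, with equality for \<open>h = w\<close>.

  Everything rests on \<open>\<integral> M t\<^sup>-\<^sup>1 d\<mu> = (XY)\<^sup>-\<^sup>1\<^sup>/\<^sup>2\<close>. Let \<open>C = (X + Y) / 2\<close>, \<open>D = (X - Y) / 2\<close> and
  \<open>Z = C\<^sup>-\<^sup>1 D\<close>. Then \<open>\<parallel>Z\<parallel> < 1\<close> because \<open>\<parallel>C x\<parallel>\<^sup>2 - \<parallel>D x\<parallel>\<^sup>2 = (X x, Y x)\<close>, and
  \<open>M t\<^sup>-\<^sup>1 = \<Sum>n. (1 - 2 t)\<^sup>n Z\<^sup>n C\<^sup>-\<^sup>1\<close>. The moments of \<open>1 - 2 t\<close> are the Taylor coefficients of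
  \<open>(1 - z\<^sup>2)\<^sup>-\<^sup>1\<^sup>/\<^sup>2\<close>, so Vandermonde's convolution shows that the integral squares to
  \<open>C\<^sup>-\<^sup>2 (1 - Z\<^sup>2)\<^sup>-\<^sup>1 = (XY)\<^sup>-\<^sup>1\<close>. The case \<open>Y = 1\<close> also supplies the square roots of coercive
  operators, with their commutation properties.\<close>

section \<open>Operator power series\<close>

text \<open>The series is formed vector by vector rather than in operator norm, so plain functions
  and \<open>^^\<close> suffice.\<close>

definition op_series :: "(nat \<Rightarrow> real) \<Rightarrow> ('a::banach \<Rightarrow> 'a) \<Rightarrow> 'a \<Rightarrow> 'a" where
  "op_series a Z x = (\<Sum>n. a n *\<^sub>R (Z ^^ n) x)"

lemma bounded_linear_funpow:
  fixes Z :: "'a::real_normed_vector \<Rightarrow> 'a"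
  shows "bounded_linear Z \<Longrightarrow> bounded_linear (Z ^^ n)"
  by (induction n) (auto simp: id_def comp_def intro: bounded_linear_ident bounded_linear_compose)

lemma norm_funpow_le:
  fixes Z :: "'a::real_normed_vector \<Rightarrow> 'a"
  assumes "\<And>x. norm (Z x) \<le> q * norm x" "0 \<le> q"
  shows "norm ((Z ^^ n) x) \<le> q ^ n * norm x"
proof (induction n)
  case (Suc n)
  have "norm ((Z ^^ Suc n) x) \<le> q * norm ((Z ^^ n) x)" using assms(1) by simp
  also have "\<dots> \<le> q * (q ^ n * norm x)" by (intro mult_left_mono Suc assms)
  finally show ?case by simp
qed simp

lemma funpow_comm:
  fixes Z :: "'a \<Rightarrow> 'a"
  shows "(\<And>x. L (Z x) = Z (L x)) \<Longrightarrow> L ((Z ^^ n) x) = (Z ^^ n) (L x)"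
  by (induction n) auto

context
  fixes Z :: "'a::banach \<Rightarrow> 'a" and q :: real
  assumes Z: "bounded_linear Z" and q: "0 \<le> q" "q < 1" and le: "\<And>x. norm (Z x) \<le> q * norm x"
begin

lemma op_series_term_le:
  assumes "\<bar>c\<bar> \<le> 1"
  shows "norm (c *\<^sub>R (Z ^^ n) x) \<le> q ^ n * norm x"
  using mult_mono[OF assms norm_funpow_le[OF le q(1), of n x]] by simp

lemma summable_power_mult: "summable (\<lambda>n. q ^ n * norm (x :: 'a))"
  using q by (intro summable_mult2 summable_geometric) auto

context
  fixes a :: "nat \<Rightarrow> real"
  assumes a: "\<And>n. \<bar>a n\<bar> \<le> 1"
begin

lemma summable_op_series: "summable (\<lambda>n. a n *\<^sub>R (Z ^^ n) x)"
  by (rule summable_comparison_test'[OF summable_power_mult]) (rule op_series_term_le[OF a])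

lemma op_series_sums: "(\<lambda>n. a n *\<^sub>R (Z ^^ n) x) sums op_series a Z x"
  unfolding op_series_def by (rule summable_sums[OF summable_op_series])

lemma bounded_linear_op_series: "bounded_linear (op_series a Z)"
proof (rule bounded_linear_intro)
  note lin = bounded_linear_funpow[OF Z]
  fix x y :: 'a and r :: real
  show "op_series a Z (x + y) = op_series a Z x + op_series a Z y"
    using sums_unique2[OF op_series_sums[of "x + y"]] sums_add[OF op_series_sums[of x] op_series_sums[of y]]
    by (simp add: linear_add[OF bounded_linear.linear[OF lin]] scaleR_add_right)
  show "op_series a Z (r *\<^sub>R x) = r *\<^sub>R op_series a Z x"
    using sums_unique2[OF op_series_sums[of "r *\<^sub>R x"]] sums_scaleR_right[OF op_series_sums[of x], of r]
    by (simp add: linear_scale[OF bounded_linear.linear[OF lin]] mult.commute)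
  have "norm (op_series a Z x) \<le> (\<Sum>n. q ^ n * norm x)"
    unfolding op_series_def
    by (rule norm_suminf_le[OF op_series_term_le[OF a] summable_power_mult])
  also have "\<dots> = norm x * (1 / (1 - q))"
    using q by (simp add: suminf_mult2[symmetric] summable_geometric suminf_geometric)
  finally show "norm (op_series a Z x) \<le> norm x * (1 / (1 - q))" .
qed

lemma op_series_comm:
  assumes "bounded_linear L" "\<And>x. L (Z x) = Z (L x)"
  shows "L (op_series a Z x) = op_series a Z (L x)"
  using sums_unique2[OF op_series_sums[of "L x"]] bounded_linear.sums[OF assms(1) op_series_sums[of x]]
  by (simp add: linear_scale[OF bounded_linear.linear[OF assms(1)]] funpow_comm[of L Z, OF assms(2)])

end

text \<open>Cauchy product: both sides are the total of one absolutely summable double family, taken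
  by rows on the left and by antidiagonals on the right.\<close>

lemma op_series_mult:
  assumes a: "\<And>n. \<bar>a n\<bar> \<le> 1" and b: "\<And>n. \<bar>b n\<bar> \<le> 1"
  shows "op_series a Z (op_series b Z x) = op_series (\<lambda>n. \<Sum>k\<le>n. a k * b (n - k)) Z x"
proof -
  define f where "f = (\<lambda>(i, j). (a i * b j) *\<^sub>R (Z ^^ (i + j)) x)"
  note lin = bounded_linear_funpow[OF Z]
  have fle: "norm (f (i, j)) \<le> q ^ i * (q ^ j * norm x)" for i j
    using op_series_term_le[of "a i * b j" "i + j" x] mult_mono[OF a[of i] b[of j]]
    by (simp add: f_def abs_mult power_add mult.assoc)
  have gs: "(\<lambda>n. q ^ n) summable_on UNIV"
    using q by (intro norm_summable_imp_summable_on) (auto simp: summable_geometric)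
  \<comment> \<open>The majorant is a product of two geometric series.\<close>
  have "(\<lambda>(i, j). q ^ i * (q ^ j * norm x)) summable_on UNIV \<times> UNIV"
  proof (rule summable_on_SigmaI)
    fix i
    show "((\<lambda>j. (case (i, j) of (i, j) \<Rightarrow> q ^ i * (q ^ j * norm x))) has_sum
        q ^ i * (infsum (\<lambda>n. q ^ n) UNIV * norm x)) UNIV"
      using has_sum_cmult_right[OF has_sum_cmult_left[OF has_sum_infsum[OF gs]]] by simp
    show "(\<lambda>i. q ^ i * (infsum (\<lambda>n. q ^ n) UNIV * norm x)) summable_on UNIV"
      by (intro summable_on_cmult_left gs)
  qed (use q in auto)
  then have "(\<lambda>p. norm (f p)) summable_on UNIV \<times> UNIV"
    by (rule summable_on_comparison_test) (use fle in auto)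
  then have fs: "f summable_on UNIV"
    using abs_summable_summable[of f UNIV] by simp
  have rows: "((\<lambda>j. f (i, j)) has_sum a i *\<^sub>R (Z ^^ i) (op_series b Z x)) UNIV" for i
  proof -
    have s: "(\<lambda>j. b j *\<^sub>R (Z ^^ j) x) sums op_series b Z x" by (rule op_series_sums[OF b])
    have "(\<lambda>j. f (i, j)) sums (a i *\<^sub>R (Z ^^ i) (op_series b Z x))"
      using sums_scaleR_right[OF bounded_linear.sums[OF lin[of i] s], of "a i"]
      by (simp add: f_def linear_scale[OF bounded_linear.linear[OF lin]] funpow_add)
    moreover have "summable (\<lambda>j. norm (f (i, j)))"
      by (rule summable_comparison_test'[of "\<lambda>j. q ^ i * (q ^ j * norm x)"])
        (use fle summable_mult[OF summable_power_mult] in auto)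
    ultimately show ?thesis by (rule norm_summable_imp_has_sum[rotated])
  qed
  have "((\<lambda>i. a i *\<^sub>R (Z ^^ i) (op_series b Z x)) has_sum infsum f UNIV) UNIV"
    by (rule has_sum_SigmaD[where f = f and B = "\<lambda>_. UNIV", OF _ rows]) (simp add: has_sum_infsum[OF fs])
  then have 1: "op_series a Z (op_series b Z x) = infsum f UNIV"
    by (metis op_series_def has_sum_imp_sums sums_unique)
  \<comment> \<open>The \<open>n\<close>-th antidiagonal holds the pairs with sum \<open>n\<close>,
    indexed by their first entry \<open>k\<close>.\<close>
  have bij: "bij_betw (\<lambda>(n, k). (k, n - k)) (SIGMA n:UNIV. {..n}) (UNIV :: (nat \<times> nat) set)"
    by (rule bij_betwI[where g = "\<lambda>(i, j). (i + j, i)"]) auto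
  have total: "((\<lambda>(n, k). f (k, n - k)) has_sum infsum f UNIV) (SIGMA n:UNIV. {..n})"
    using has_sum_infsum[OF fs] has_sum_reindex_bij_betw[OF bij, of f] by (simp add: case_prod_unfold)
  have diagonals: "((\<lambda>k. f (k, n - k)) has_sum (\<Sum>k\<le>n. a k * b (n - k)) *\<^sub>R (Z ^^ n) x) {..n}" for n
    by (rule has_sum_finiteI) (simp_all add: f_def scaleR_left.sum)
  have "((\<lambda>n. (\<Sum>k\<le>n. a k * b (n - k)) *\<^sub>R (Z ^^ n) x) has_sum infsum f UNIV) UNIV"
    by (rule has_sum_SigmaD[OF total]) (simp add: diagonals)
  then have "op_series (\<lambda>n. \<Sum>k\<le>n. a k * b (n - k)) Z x = infsum f UNIV"
    unfolding op_series_def by (rule sums_unique[OF has_sum_imp_sums, symmetric])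
  with 1 show ?thesis by simp
qed

text \<open>Shifting the Neumann series by one term. Thus it inverts
  \<open>x - u *\<^sub>R Z x\<close> from the right.\<close>

lemma op_series_geometric:
  assumes "\<bar>u\<bar> \<le> 1"
  shows "op_series (\<lambda>n. u ^ n) Z x = x + u *\<^sub>R Z (op_series (\<lambda>n. u ^ n) Z x)"
proof -
  have u: "\<bar>u ^ n\<bar> \<le> 1" for n using assms by (simp add: power_abs power_le_one)
  have "(\<lambda>n. u ^ Suc n *\<^sub>R (Z ^^ Suc n) x) sums (u *\<^sub>R Z (op_series (\<lambda>n. u ^ n) Z x))"
    using sums_scaleR_right[OF bounded_linear.sums[OF Z op_series_sums[OF u]], of u]
    by (simp add: linear_scale[OF bounded_linear.linear[OF Z]])
  from sums_unique2[OF op_series_sums[OF u] sums_Suc[OF this]] show ?thesis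
    by (subst add.commute) simp
qed

text \<open>Weierstrass M-test: the majorant \<open>q ^ n * norm x\<close> does not depend on
  \<open>t\<close>.\<close>

lemma continuous_on_op_series:
  assumes "\<And>n. continuous_on S (\<lambda>t. a t n)" "\<And>t n. t \<in> S \<Longrightarrow> \<bar>a t n\<bar> \<le> 1"
  shows "continuous_on S (\<lambda>t. op_series (a t) Z x)"
  unfolding op_series_def
proof (rule uniform_limit_theorem)
  show "uniform_limit S (\<lambda>n t. \<Sum>i<n. a t i *\<^sub>R (Z ^^ i) x) (\<lambda>t. \<Sum>i. a t i *\<^sub>R (Z ^^ i) x) sequentially"
    by (rule Weierstrass_m_test[OF _ summable_power_mult[of x]]) (use op_series_term_le assms in auto)
qed (auto intro!: always_eventually continuous_intros assms)

end

section \<open>Moments of the arcsine measure\<close>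

lemma space_arcsine_measure [simp]: "space arcsine_measure = {0..1}"
  by (simp add: arcsine_measure_def space_restrict_space)

lemma borel_measurable_arcsine_measure:
  "f \<in> borel_measurable borel \<Longrightarrow> f \<in> borel_measurable arcsine_measure"
  by (auto simp: arcsine_measure_def intro: measurable_restrict_space1)

text \<open>A real-valued density for use with the gauge integral. At 0 and 1 it is 0, by the
  convention for division by zero.\<close>

definition arcsine_density :: "real \<Rightarrow> real" where
  "arcsine_density t = 1 / (pi * sqrt (t * (1 - t)))"

lemma borel_measurable_arcsine_density [measurable]: "arcsine_density \<in> borel_measurable borel"
  unfolding arcsine_density_def by measurable

lemma arcsine_density_nonneg: "t \<in> {0..1} \<Longrightarrow> 0 \<le> arcsine_density t"
  by (simp add: arcsine_density_def)

lemma arcsine_measure_eq: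
  "arcsine_measure = density (restrict_space lborel {0..1}) (\<lambda>t. ennreal (arcsine_density t))"
  by (simp add: arcsine_measure_def arcsine_density_def)

text \<open>The primitive arcsin (2t - 1) / pi is continuous up to the endpoints, although the
  density is unbounded there. Hence the form of the fundamental theorem that differentiates only in
  the interior.\<close>

lemma arcsine_density_has_integral: "(arcsine_density has_integral 1) {0..1}"
proof -
  have "(arcsine_density has_integral (arcsin (2 * 1 - 1) / pi - arcsin (2 * 0 - 1) / pi)) {0..1}"
  proof (rule fundamental_theorem_of_calculus_interior)
    show "continuous_on {0..1} (\<lambda>t::real. arcsin (2 * t - 1) / pi)"
      by (intro continuous_intros) auto
    fix t :: real assume t: "t \<in> {0<..<1}"
    have "sqrt (1 - (2 * t - 1)\<^sup>2) = 2 * sqrt (t * (1 - t))"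
      using real_sqrt_mult[of 4 "t * (1 - t)"] by (simp add: power2_eq_square algebra_simps)
    then show "((\<lambda>t. arcsin (2 * t - 1) / pi) has_vector_derivative arcsine_density t) (at t)"
      using t unfolding has_real_derivative_iff_has_vector_derivative[symmetric]
      by (auto intro!: derivative_eq_intros simp: arcsine_density_def field_simps)
  qed simp
  then show ?thesis by (simp add: field_simps)
qed

lemma prob_arcsine_measure: "emeasure arcsine_measure (space arcsine_measure) = 1"
proof -
  have "emeasure arcsine_measure {0..1} = (\<integral>\<^sup>+t. ennreal (arcsine_density t) \<partial>restrict_space lborel {0..1})"
    unfolding arcsine_measure_eq
    by (subst emeasure_density)
      (auto simp: sets_restrict_space indicator_def space_restrict_space measurable_restrict_space1
        intro!: nn_integral_cong image_eqI[of _ _ "{0..1}"])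
  also have "\<dots> = (\<integral>\<^sup>+t. ennreal (arcsine_density t * indicator {0..1} t) \<partial>lborel)"
    by (subst nn_integral_restrict_space) (auto intro!: nn_integral_cong simp: indicator_def)
  also have "\<dots> = ennreal 1"
  proof (rule nn_integral_has_integral_lborel)
    show "0 \<le> arcsine_density t * indicator {0..1} t" for t
      using arcsine_density_nonneg[of t] by (simp add: indicator_def)
    have "(\<lambda>t. arcsine_density t * indicator {0..1} t) =
        (\<lambda>t. if t \<in> {0..1} then arcsine_density t else 0)"
      by (auto simp: indicator_def)
    then show "((\<lambda>t. arcsine_density t * indicator {0..1} t) has_integral 1) UNIV"
      using arcsine_density_has_integral by (simp only: has_integral_restrict_UNIV)
  qed measurable
  finally show ?thesis by simp
qed

interpretation arcsine_measure: finite_measure arcsine_measure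
  by standard (simp add: prob_arcsine_measure[simplified])

text \<open>Passes to the gauge integral, where the fundamental theorem of calculus can evaluate
  moments.\<close>

lemma has_integral_arcsine_measure:
  fixes \<phi> :: "real \<Rightarrow> real"
  assumes [measurable]: "\<phi> \<in> borel_measurable borel" and "integrable arcsine_measure \<phi>"
  shows "((\<lambda>t. arcsine_density t * \<phi> t) has_integral integral\<^sup>L arcsine_measure \<phi>) {0..1}"
proof -
  let ?R = "restrict_space lborel {0..1::real}"
  have m: "\<phi> \<in> borel_measurable ?R" "arcsine_density \<in> borel_measurable ?R"
    by (auto intro!: measurable_restrict_space1)
  have nn: "AE t in ?R. 0 \<le> arcsine_density t"
    by (rule AE_I2) (simp add: arcsine_density_nonneg space_restrict_space)
  have eq: "(\<lambda>t. indicator {0..1} t *\<^sub>R (arcsine_density t * \<phi> t)) =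
      (\<lambda>t. if t \<in> {0..1} then arcsine_density t * \<phi> t else 0)"
    by (auto simp: indicator_def)
  have int: "integrable lborel (\<lambda>t. indicator {0..1} t *\<^sub>R (arcsine_density t * \<phi> t))"
    using assms(2) integrable_density[OF m nn]
    by (simp add: arcsine_measure_eq integrable_restrict_space)
  have "integral\<^sup>L arcsine_measure \<phi> = integral\<^sup>L lborel (\<lambda>t. indicator {0..1} t *\<^sub>R (arcsine_density t * \<phi> t))"
    using integral_density[OF m nn]
    by (simp add: arcsine_measure_eq integral_restrict_space)
  then show ?thesis
    using has_integral_integral_lborel[OF int] unfolding eq has_integral_restrict_UNIV by simp
qed

text \<open>The coefficient of z^k in (1 - z)^(-1/2), equal to the central binomial coefficient (2k
  choose k) divided by 4^k.\<close>

definition sqrt_coeff :: "nat \<Rightarrow> real" where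
  "sqrt_coeff k = (-1) ^ k * ((-1/2) gchoose k)"

lemma sqrt_coeff_Suc: "sqrt_coeff (Suc k) = sqrt_coeff k * ((2 * k + 1) / (2 * k + 2))"
proof -
  have "((-1/2) gchoose Suc k) * (2 * k + 2) = - ((-1/2 :: real) gchoose k) * (2 * k + 1)"
    using gbinomial_mult_1[of "-1/2 :: real" k] by (simp add: algebra_simps)
  then have "((-1/2) gchoose Suc k) = - ((-1/2 :: real) gchoose k) * (2 * k + 1) / (2 * k + 2)"
    by (rule eq_divide_imp[rotated]) simp
  then show ?thesis by (simp add: sqrt_coeff_def add.commute)
qed

text \<open>Consecutive ratios lie in [0, 1]. The bound meets the coefficient hypothesis of the
  operator power series.\<close>

lemma sqrt_coeff_bounds: "0 \<le> sqrt_coeff k \<and> sqrt_coeff k \<le> 1"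
proof (induction k)
  case (Suc k)
  have "sqrt_coeff k * ((2 * k + 1) / (2 * k + 2)) \<le> 1 * 1"
    using Suc by (intro mult_mono) auto
  with Suc show ?case by (auto simp: sqrt_coeff_Suc add.commute mult.commute)
qed (simp add: sqrt_coeff_def)

text \<open>The square of (1 - z)^(-1/2) is the geometric series: Vandermonde with both upper
  arguments -1/2 leaves (-1 choose n) = (-1)^n.\<close>

lemma sqrt_coeff_convolution: "(\<Sum>k\<le>n. sqrt_coeff k * sqrt_coeff (n - k)) = 1"
proof -
  have "(\<Sum>k\<le>n. sqrt_coeff k * sqrt_coeff (n - k)) =
      (\<Sum>k\<le>n. (-1) ^ n * (((-1/2) gchoose k) * ((-1/2) gchoose (n - k))))"
    by (intro sum.cong) (auto simp: sqrt_coeff_def algebra_simps simp flip: power_add)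
  also have "\<dots> = (-1) ^ n * ((-1) gchoose n)"
    using gbinomial_Vandermonde[of "-1/2 :: real" "-1/2" n] by (simp add: sum_distrib_left[symmetric] atLeast0AtMost)
  also have "\<dots> = 1"
    by (simp add: gbinomial_minus binomial_gbinomial[symmetric, of n n, simplified] flip: power_mult_distrib)
  finally show ?thesis .
qed

text \<open>Closed form for the moments of 1 - 2t. The odd ones vanish because the measure is
  symmetric about 1/2.\<close>

definition arcsine_moment :: "nat \<Rightarrow> real" where
  "arcsine_moment n = (if even n then sqrt_coeff (n div 2) else 0)"

lemma integrable_arcsine_measure_power: "integrable arcsine_measure (\<lambda>t. (1 - 2 * t) ^ n)"
proof (rule arcsine_measure.integrable_const_bound[of _ 1])
  show "AE t in arcsine_measure. norm ((1 - 2 * t) ^ n) \<le> 1"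
    by (rule AE_I2) (auto simp: power_abs intro!: power_le_one)
  show "(\<lambda>t. (1 - 2 * t) ^ n) \<in> borel_measurable arcsine_measure"
    by (rule borel_measurable_arcsine_measure) measurable
qed

text \<open>Integrates the derivative of (1 - 2t)^n sqrt (t (1 - t)), a function that vanishes at
  both endpoints. For \<open>n = 0\<close> the truncated \<open>n - 1\<close> is harmless, as its
  factor \<open>n\<close> is 0.\<close>

lemma integral_arcsine_measure_power_rec:
  "(n + 1) * integral\<^sup>L arcsine_measure (\<lambda>t. (1 - 2 * t) ^ (n + 1)) =
    n * integral\<^sup>L arcsine_measure (\<lambda>t. (1 - 2 * t) ^ (n - 1))"
proof -
  let ?\<phi> = "\<lambda>t::real. (n + 1) * (1 - 2 * t) ^ (n + 1) - n * (1 - 2 * t) ^ (n - 1)"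
  \<comment> \<open>The factor 2 / pi makes the derivative exactly
    \<open>arcsine_density t * ?\<phi> t\<close>.\<close>
  let ?F = "\<lambda>t::real. 2 / pi * ((1 - 2 * t) ^ n * sqrt (t * (1 - t)))"
  have "((\<lambda>t. arcsine_density t * ?\<phi> t) has_integral (?F 1 - ?F 0)) {0..1}"
  proof (rule fundamental_theorem_of_calculus_interior)
    show "continuous_on {0..1} ?F" by (intro continuous_intros)
    fix t :: real assume t: "t \<in> {0<..<1}"
    define s where "s = sqrt (t * (1 - t))"
    have s: "0 < s" "s * s = t * (1 - t)" using t by (auto simp: s_def)
    have p: "real n * (1 - 2 * t) ^ (n - 1) * (1 - 2 * t) ^ 2 = n * (1 - 2 * t) ^ (n + 1)"
      by (cases n) (auto simp: power2_eq_square)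
    have d: "(?F has_real_derivative 2 / pi * (- 2 * n * (1 - 2 * t) ^ (n - 1) * s +
        (1 - 2 * t) ^ n * ((1 - 2 * t) / (2 * s)))) (at t)"
      using t by (auto intro!: derivative_eq_intros simp: s_def field_simps)
    have e1: "2 / pi * (- 2 * n * (1 - 2 * t) ^ (n - 1) * s +
        (1 - 2 * t) ^ n * ((1 - 2 * t) / (2 * s))) =
      ((1 - 2 * t) ^ (n + 1) - n * (1 - 2 * t) ^ (n - 1) * (4 * (s * s))) / (pi * s)"
      using s(1) by (simp add: field_simps)
    have e2: "4 * (s * s) = 1 - (1 - 2 * t) ^ 2"
      unfolding s(2) by (simp add: power2_eq_square algebra_simps)
    have e3: "(1 - 2 * t) ^ (n + 1) - n * (1 - 2 * t) ^ (n - 1) * (1 - (1 - 2 * t) ^ 2) = ?\<phi> t"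
      using p by (simp add: algebra_simps)
    have "(?F has_real_derivative ?\<phi> t / (pi * s)) (at t)"
      using d unfolding e1 e2 e3 .
    then show "(?F has_vector_derivative (arcsine_density t * ?\<phi> t)) (at t)"
      by (simp add: has_real_derivative_iff_has_vector_derivative[symmetric] arcsine_density_def s_def)
  qed simp
  moreover note int = integrable_mult_right[OF integrable_arcsine_measure_power]
  have "((\<lambda>t. arcsine_density t * ?\<phi> t) has_integral integral\<^sup>L arcsine_measure ?\<phi>) {0..1}"
  proof (rule has_integral_arcsine_measure)
    show "integrable arcsine_measure ?\<phi>"
      by (rule Bochner_Integration.integrable_diff[OF int int])
  qed measurable
  ultimately have "integral\<^sup>L arcsine_measure ?\<phi> = ?F 1 - ?F 0"
    using has_integral_unique by blast
  then show ?thesis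
    unfolding Bochner_Integration.integral_diff[OF int int] by (simp add: add.commute)
qed

text \<open>The recursion moves in steps of two, so it starts from the total mass and from the first
  moment, which its case \<open>n = 0\<close> forces to be 0.\<close>

lemma integral_arcsine_measure_power:
  "integral\<^sup>L arcsine_measure (\<lambda>t. (1 - 2 * t) ^ n) = arcsine_moment n"
proof (induction n rule: less_induct)
  case (less n)
  consider "n = 0" | "n = 1" | k where "n = Suc (Suc k)"
    by (metis One_nat_def not0_implies_Suc)
  then show ?case
  proof cases
    case 1
    then show ?thesis
      using prob_arcsine_measure by (simp add: arcsine_moment_def sqrt_coeff_def measure_def)
  next
    case 2
    then show ?thesis
      using integral_arcsine_measure_power_rec[of 0] by (simp add: arcsine_moment_def)
  next
    case 3
    then have "(k + 2) * integral\<^sup>L arcsine_measure (\<lambda>t. (1 - 2 * t) ^ n) = (k + 1) * arcsine_moment k"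
      using integral_arcsine_measure_power_rec[of "Suc k"] less[of k] by (simp add: algebra_simps)
    moreover have "(k + 2) * arcsine_moment n = (k + 1) * arcsine_moment k"
    proof (cases "even k")
      case True
      then obtain j where j: "k = 2 * j" by blast
      then have "arcsine_moment n = sqrt_coeff (Suc j)"
        using 3 by (simp add: arcsine_moment_def)
      then show ?thesis using j by (simp add: arcsine_moment_def[of "2 * j"] sqrt_coeff_Suc add.commute)
    qed (use 3 in \<open>simp add: arcsine_moment_def\<close>)
    ultimately have "(k + 2) * integral\<^sup>L arcsine_measure (\<lambda>t. (1 - 2 * t) ^ n) = (k + 2) * arcsine_moment n"
      by simp
    then show ?thesis by (simp add: mult_cancel_left)
  qed
qed

lemma AE_arcsine_measure_interior: "AE t in arcsine_measure. 0 < t \<and> t < 1"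
proof -
  have "AE t in lborel. t \<noteq> (0::real)" "AE t in lborel. t \<noteq> (1::real)"
    by (rule AE_lborel_singleton)+
  then have "AE t in lborel. t \<in> {0..1} \<longrightarrow> 0 < t \<and> t < (1::real)"
    by eventually_elim auto
  then have "AE t in restrict_space lborel {0..1}. 0 < t \<and> t < (1::real)"
    by (subst AE_restrict_space_iff) auto
  moreover have "(\<lambda>t. ennreal (arcsine_density t)) \<in> borel_measurable (restrict_space lborel {0..1})"
    by (intro measurable_restrict_space1) measurable
  ultimately show ?thesis
    unfolding arcsine_measure_eq by (subst AE_density) auto
qed

section \<open>Coercive operators\<close>

text \<open>Stated for the real inner product only. Complex linearity of a constructed operator is
  recovered later from its commuting with scalar multiplication.\<close>

definition coercive_op :: "('a::real_inner \<Rightarrow> 'a) \<Rightarrow> bool" where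
  "coercive_op T \<longleftrightarrow> bounded_linear T \<and> (\<forall>x y. inner (T x) y = inner x (T y)) \<and>
    (\<exists>m>0. \<forall>x. m * (norm x)\<^sup>2 \<le> inner (T x) x)"

lemma coercive_opD:
  assumes "coercive_op T"
  shows "bounded_linear T" "inner (T x) y = inner x (T y)" "0 \<le> inner (T x) x"
proof -
  from assms obtain m where "m > 0" "m * (norm x)\<^sup>2 \<le> inner (T x) x"
    unfolding coercive_op_def by blast
  then show "0 \<le> inner (T x) x" by (smt (verit) mult_nonneg_nonneg zero_le_power2)
qed (use assms in \<open>auto simp: coercive_op_def\<close>)

lemma coercive_opE:
  assumes "coercive_op T"
  obtains m where "m > 0" "\<And>x. m * (norm x)\<^sup>2 \<le> inner (T x) x"
  using assms unfolding coercive_op_def by blast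

lemma coercive_op_inner_eq_0D: "coercive_op T \<Longrightarrow> inner (T x) x = 0 \<Longrightarrow> x = 0"
  by (metis coercive_opE linorder_not_less mult_pos_pos zero_less_norm_iff zero_less_power2 zero_less_power)

lemma coercive_op_ident: "coercive_op (\<lambda>x. x)"
  unfolding coercive_op_def by (auto intro!: exI[of _ 1] bounded_linear_ident simp: dot_square_norm)

text \<open>Expanding \<open>0 \<le> inner (T z) z\<close> at \<open>z = x - T x /\<^sub>R K\<close>, with \<open>K\<close> a bound of \<open>T\<close>, gives
  \<open>(norm (T x))\<^sup>2 \<le> K * inner (T x) x\<close>.\<close>

lemma coercive_op_of_bounded_below:
  assumes T: "bounded_linear T" and sym: "\<And>x y. inner (T x) y = inner x (T y)"
    and nonneg: "\<And>x. 0 \<le> inner (T x) x" and c: "0 < c" "\<And>x. c * norm x \<le> norm (T x)"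
  shows "coercive_op T"
proof -
  obtain K where K: "0 < K" "\<And>x. norm (T x) \<le> norm x * K"
    using bounded_linear.pos_bounded[OF T] by blast
  have "c\<^sup>2 / K * (norm x)\<^sup>2 \<le> inner (T x) x" for x
  proof -
    have "inner (T (T x)) (T x) \<le> norm (T (T x)) * norm (T x)" by (rule norm_cauchy_schwarz)
    also have "\<dots> \<le> K * (norm (T x))\<^sup>2"
      using mult_right_mono[OF K(2)[of "T x"], of "norm (T x)"] by (simp add: power2_eq_square mult_ac)
    finally have le: "inner (T (T x)) (T x) / K\<^sup>2 \<le> (norm (T x))\<^sup>2 / K"
      using K(1) by (simp add: field_simps power2_eq_square)
    have "0 \<le> inner (T (x - T x /\<^sub>R K)) (x - T x /\<^sub>R K)" by (rule nonneg)
    also have "\<dots> = inner (T x) x - 2 * (norm (T x))\<^sup>2 / K + inner (T (T x)) (T x) / K\<^sup>2"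
      using K(1) sym[of "T x" x] by (simp add: linear_diff[OF bounded_linear.linear[OF T]]
          linear_scale[OF bounded_linear.linear[OF T]] inner_diff_left inner_diff_right
          dot_square_norm power2_eq_square field_simps)
    finally have "(norm (T x))\<^sup>2 / K \<le> inner (T x) x"
      using le by simp
    moreover have "c\<^sup>2 * (norm x)\<^sup>2 \<le> (norm (T x))\<^sup>2"
      using power_mono[OF c(2)[of x], of 2] c(1) by (simp add: power_mult_distrib)
    ultimately show ?thesis
      using K(1) divide_right_mono[of "c\<^sup>2 * (norm x)\<^sup>2" "(norm (T x))\<^sup>2" K] by simp
  qed
  moreover have "0 < c\<^sup>2 / K" using c(1) K(1) by simp
  ultimately show ?thesis
    unfolding coercive_op_def using T sym by blast
qed

text \<open>Weights with sum 1 cannot both vanish, so the combined constant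
  \<open>s * m + t * n\<close> stays positive even at the endpoints.\<close>

lemma coercive_op_convex:
  assumes S: "coercive_op S" and T: "coercive_op T" and st: "0 \<le> s" "0 \<le> t" "s + t = 1"
  shows "coercive_op (\<lambda>x. s *\<^sub>R S x + t *\<^sub>R T x)"
proof -
  obtain m n where mn: "0 < m" "\<And>x. m * (norm x)\<^sup>2 \<le> inner (S x) x"
    "0 < n" "\<And>x. n * (norm x)\<^sup>2 \<le> inner (T x) x"
    using coercive_opE[OF S] coercive_opE[OF T] by metis
  have "(s * m + t * n) * (norm x)\<^sup>2 \<le> inner (s *\<^sub>R S x + t *\<^sub>R T x) x" for x
    using mult_left_mono[OF mn(2)[of x] st(1)] mult_left_mono[OF mn(4)[of x] st(2)]
    by (simp add: inner_add_left algebra_simps)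
  moreover have "0 < s * m + t * n"
  proof (cases "s = 0")
    case False
    then have "0 < s * m" "0 \<le> t * n" using st mn by auto
    then show ?thesis by linarith
  qed (use st mn in auto)
  moreover have "bounded_linear (\<lambda>x. s *\<^sub>R S x + t *\<^sub>R T x)"
    by (intro bounded_linear_add bounded_linear_const_scaleR coercive_opD S T)
  ultimately show ?thesis
    unfolding coercive_op_def
    by (auto simp: inner_add_left inner_add_right coercive_opD(2)[OF S] coercive_opD(2)[OF T])
qed

text \<open>With \<open>m\<close> the coercivity constant and \<open>K\<close> a bound of \<open>T\<close>, the map
  \<open>x \<mapsto> x - s *\<^sub>R (T x - y)\<close> contracts for \<open>s = m / K\<^sup>2\<close>.\<close>

lemma coercive_op_surj:
  fixes T :: "'a::{real_inner,banach} \<Rightarrow> 'a"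
  assumes "coercive_op T"
  obtains x where "T x = y"
proof -
  note T = coercive_opD(1)[OF assms]
  note lin = bounded_linear.linear[OF T]
  obtain m where m: "0 < m" "\<And>x. m * (norm x)\<^sup>2 \<le> inner (T x) x"
    by (rule coercive_opE[OF assms]) blast
  obtain K where K: "0 < K" "\<And>x. norm (T x) \<le> norm x * K"
    using bounded_linear.pos_bounded[OF T] by blast
  define s where "s = m / K\<^sup>2"
  define F where "F x = x - s *\<^sub>R (T x - y)" for x
  define q where "q = sqrt (max 0 (1 - m\<^sup>2 / K\<^sup>2))"
  have s: "0 < s" using m K by (simp add: s_def)
  have q: "0 \<le> q" "q < 1" using m K by (auto simp: q_def)
  have "norm (x - s *\<^sub>R T x) \<le> q * norm x" for x
  proof (rule power2_le_imp_le)
    have "(norm (x - s *\<^sub>R T x))\<^sup>2 = (norm x)\<^sup>2 - 2 * s * inner (T x) x + s\<^sup>2 * (norm (T x))\<^sup>2"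
      unfolding power2_norm_eq_inner
      by (simp add: inner_diff_left inner_diff_right inner_commute[of x "T x"] power2_eq_square algebra_simps)
    also have "\<dots> \<le> (norm x)\<^sup>2 - 2 * s * (m * (norm x)\<^sup>2) + s\<^sup>2 * (norm x * K)\<^sup>2"
      using s m(2)[of x] K(2)[of x] by (intro add_mono diff_mono mult_left_mono power_mono) auto
    also have "\<dots> = (1 - m\<^sup>2 / K\<^sup>2) * (norm x)\<^sup>2"
      using K(1) by (simp add: s_def field_simps power2_eq_square)
    also have "\<dots> \<le> q\<^sup>2 * (norm x)\<^sup>2"
      by (intro mult_right_mono) (auto simp: q_def)
    finally show "(norm (x - s *\<^sub>R T x))\<^sup>2 \<le> (q * norm x)\<^sup>2"
      by (simp add: power_mult_distrib)
  qed (use q in auto)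
  moreover have "F x - F z = (x - z) - s *\<^sub>R T (x - z)" for x z
    by (simp add: F_def linear_diff[OF lin] scaleR_diff_right)
  ultimately have "dist (F x) (F z) \<le> q * dist x z" for x z
    by (simp add: dist_norm)
  then have "\<exists>!x. F x = x"
    using q by (intro banach_fix_type[where c = q]) auto
  then obtain x where "F x = x" by blast
  then have "T x = y" using s by (simp add: F_def)
  then show ?thesis by (rule that)
qed

text \<open>Coercivity gives injectivity, and at \<open>Ti x\<close> it reads m |Ti x|^2 \<le> (x,
  Ti x), which bounds the inverse by 1 / m.\<close>

lemma coercive_op_inverse:
  fixes T :: "'a::{real_inner,banach} \<Rightarrow> 'a"
  assumes "coercive_op T"
  obtains Ti where "bounded_linear Ti" "\<And>x. T (Ti x) = x" "\<And>x. Ti (T x) = x"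
proof -
  note lin = bounded_linear.linear[OF coercive_opD(1)[OF assms]]
  have inj: "x = z" if "T x = T z" for x z
    using coercive_op_inner_eq_0D[OF assms, of "x - z"] that by (simp add: linear_diff[OF lin])
  have "\<exists>z. T z = x" for x by (rule coercive_op_surj[OF assms, of x]) blast
  then obtain Ti where Ti: "\<And>x. T (Ti x) = x" by metis
  obtain m where m: "0 < m" "\<And>x. m * (norm x)\<^sup>2 \<le> inner (T x) x"
    by (rule coercive_opE[OF assms]) blast
  have "bounded_linear Ti"
  proof (rule bounded_linear_intro)
    show "Ti (x + z) = Ti x + Ti z" for x z by (rule inj) (simp add: Ti linear_add[OF lin])
    show "Ti (r *\<^sub>R x) = r *\<^sub>R Ti x" for r x by (rule inj) (simp add: Ti linear_scale[OF lin])
    show "norm (Ti x) \<le> norm x * (1 / m)" for x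
    proof (cases "Ti x = 0")
      case False
      have "m * (norm (Ti x))\<^sup>2 \<le> norm x * norm (Ti x)"
        using m(2)[of "Ti x"] norm_cauchy_schwarz[of x "Ti x"] by (simp add: Ti)
      then have "m * norm (Ti x) \<le> norm x"
        using False by (simp add: power2_eq_square flip: mult.assoc)
      then show ?thesis using m(1) by (simp add: field_simps)
    qed (use m in simp)
  qed
  then show ?thesis using that[OF _ Ti] inj Ti by blast
qed

section \<open>The arcsine mean of two commuting operators\<close>

text \<open>Here \<open>w y t\<close> is the inverse of t X + (1 - t) Y applied to \<open>y\<close>,
  and \<open>R\<close> is the mean of these inverses, stated weakly by testing against
  \<open>z\<close>. The constant \<open>m\<close> keeps the norm of \<open>Z\<close> below
  1.\<close>

lemma arcsine_mean_exists:
  fixes X Y :: "'a::{real_inner,banach} \<Rightarrow> 'a"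
  assumes X: "coercive_op X" and Y: "coercive_op Y" and comm: "\<And>x. X (Y x) = Y (X x)"
    and m: "0 < m" "\<And>x. m * (norm x)\<^sup>2 \<le> inner (X x) (Y x)"
  obtains R w where "bounded_linear R" "\<And>x y. inner (R x) y = inner x (R y)" "\<And>x. 0 \<le> inner (R x) x"
    "\<And>x. R (R (X (Y x))) = x"
    "\<And>L x. bounded_linear L \<Longrightarrow> (\<And>x. L (X x) = X (L x)) \<Longrightarrow> (\<And>x. L (Y x) = Y (L x)) \<Longrightarrow>
      L (R x) = R (L x)"
    "\<And>y. continuous_on {0..1} (w y)"
    "\<And>y t. t \<in> {0..1} \<Longrightarrow> t *\<^sub>R X (w y t) + (1 - t) *\<^sub>R Y (w y t) = y"
    "\<And>y t. t \<in> {0..1} \<Longrightarrow> 0 \<le> inner (w y t) y"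
    "\<And>y z. has_bochner_integral arcsine_measure (\<lambda>t. inner (w y t) z) (inner (R y) z)"
proof -
  note linX = bounded_linear.linear[OF coercive_opD(1)[OF X]]
  note linY = bounded_linear.linear[OF coercive_opD(1)[OF Y]]
  \<comment> \<open>With these, t X + (1 - t) Y = C - (1 - 2t) D, so the dependence on
    \<open>t\<close> sits in 1 - 2t, whose moments are known.\<close>
  define C where "C x = (1/2) *\<^sub>R X x + (1/2) *\<^sub>R Y x" for x
  define D where "D x = (1/2) *\<^sub>R X x - (1/2) *\<^sub>R Y x" for x
  have C: "coercive_op C"
    unfolding C_def by (rule coercive_op_convex[OF X Y]) auto
  note linC = bounded_linear.linear[OF coercive_opD(1)[OF C]]
  have D: "bounded_linear D"
    unfolding D_def
    by (intro bounded_linear_sub bounded_linear_const_scaleR coercive_opD(1) X Y)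
  note linD = bounded_linear.linear[OF D]
  obtain Ci where Ci: "bounded_linear Ci" and C_Ci: "\<And>x. C (Ci x) = x" and Ci_C: "\<And>x. Ci (C x) = x"
    by (rule coercive_op_inverse[OF C]) blast
  have C_comm: "L (C x) = C (L x)" if "bounded_linear L" "\<And>x. L (X x) = X (L x)" "\<And>x. L (Y x) = Y (L x)" for L x
    using that(2,3) by (simp add: C_def linear_add[OF bounded_linear.linear[OF that(1)]]
        linear_scale[OF bounded_linear.linear[OF that(1)]])
  have D_comm: "L (D x) = D (L x)" if "bounded_linear L" "\<And>x. L (X x) = X (L x)" "\<And>x. L (Y x) = Y (L x)" for L x
    using that(2,3) by (simp add: D_def linear_diff[OF bounded_linear.linear[OF that(1)]]
        linear_scale[OF bounded_linear.linear[OF that(1)]])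
  have Ci_comm: "L (Ci x) = Ci (L x)" if "\<And>x. L (C x) = C (L x)" for L x
    using that[of "Ci x"] by (metis C_Ci Ci_C)
  have X_D: "X (D x) = D (X x)" for x
    by (rule D_comm) (auto simp: coercive_opD(1) X comm)
  have Y_D: "Y (D x) = D (Y x)" for x
    by (rule D_comm) (auto simp: coercive_opD(1) Y comm)
  have D_C: "D (C x) = C (D x)" for x
    by (rule C_comm) (auto simp: D X_D Y_D)
  have D_Ci: "D (Ci x) = Ci (D x)" for x
    by (rule Ci_comm) (rule D_C)
  define Z where "Z x = Ci (D x)" for x
  have Z: "bounded_linear Z"
    unfolding Z_def by (rule bounded_linear_compose[OF Ci D])
  obtain K where K: "0 < K" "\<And>x. norm (C x) \<le> norm x * K"
    using bounded_linear.pos_bounded[OF coercive_opD(1)[OF C]] by blast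
  \<comment> \<open>Chosen so that q^2 is at least 1 - m / K^2; \<open>max 0\<close> keeps the root
    nonnegative.\<close>
  define q where "q = sqrt (max 0 (1 - m / K\<^sup>2))"
  have q: "0 \<le> q" "q < 1" using m K by (auto simp: q_def)
  have Z_le: "norm (Z x) \<le> q * norm x" for x
  proof (rule power2_le_imp_le)
    \<comment> \<open>By commutation \<open>Z x = D v\<close> while \<open>x = C v\<close>, so the
      claim compares the norms of \<open>D v\<close> and \<open>C v\<close>.\<close>
    define v where "v = Ci x"
    have x: "x = C v" by (simp add: v_def C_Ci)
    have "(norm x)\<^sup>2 / K\<^sup>2 \<le> (norm v)\<^sup>2"
      using power_mono[OF K(2)[of v], of 2] K(1) by (simp add: x power_mult_distrib divide_le_eq)
    then have "m * ((norm x)\<^sup>2 / K\<^sup>2) \<le> m * (norm v)\<^sup>2"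
      using m(1) by (intro mult_left_mono) auto
    also have "\<dots> \<le> inner (X v) (Y v)" by (rule m(2))
    also have "\<dots> = (norm (C v))\<^sup>2 - (norm (D v))\<^sup>2"
      unfolding power2_norm_eq_inner C_def D_def
      by (simp add: inner_add_left inner_add_right inner_diff_left inner_diff_right inner_commute[of "Y v" "X v"] field_simps)
    finally have "(norm (D v))\<^sup>2 \<le> (1 - m / K\<^sup>2) * (norm x)\<^sup>2"
      by (simp add: x algebra_simps)
    also have "\<dots> \<le> q\<^sup>2 * (norm x)\<^sup>2"
      by (intro mult_right_mono) (auto simp: q_def)
    finally show "(norm (Z x))\<^sup>2 \<le> (q * norm x)\<^sup>2"
      by (simp add: Z_def v_def D_Ci power_mult_distrib)
  qed (use q in auto)
  have ZZ: "bounded_linear (Z \<circ> Z)"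
    unfolding comp_def by (rule bounded_linear_compose[OF Z Z])
  have qq: "0 \<le> q * q" "q * q < 1"
    using q mult_left_le[of q q] by auto
  have ZZ_le: "norm ((Z \<circ> Z) x) \<le> q * q * norm x" for x
    using order_trans[OF Z_le mult_left_mono[OF Z_le q(1)], of x] by simp
  note ctx = Z q Z_le and ctx2 = ZZ qq ZZ_le
  have coeff: "\<bar>sqrt_coeff n\<bar> \<le> 1" for n using sqrt_coeff_bounds[of n] by simp
  have u: "\<bar>(1 - 2 * t) ^ n\<bar> \<le> 1" if "t \<in> {0..1}" for t :: real and n
    using that by (auto simp: power_abs intro!: power_le_one)

  \<comment> \<open>\<open>G\<close> is (1 - Z^2)^(-1/2), a series in Z^2 because the odd moments
    vanish; \<open>R\<close> is G C^(-1); \<open>w y t\<close> is the Neumann series of (1 - (1 -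
    2t) Z)^(-1) at C^(-1) y.\<close>
  define G where "G = op_series sqrt_coeff (Z \<circ> Z)"
  define R where "R x = G (Ci x)" for x
  define w where "w y t = op_series (\<lambda>n. (1 - 2 * t) ^ n) Z (Ci y)" for y and t :: real
  have G: "bounded_linear G"
    unfolding G_def by (rule bounded_linear_op_series[OF ctx2 coeff])
  have G_comm: "L (G x) = G (L x)" if "bounded_linear L" "\<And>x. L (Z x) = Z (L x)" for L x
    unfolding G_def using that by (intro op_series_comm[OF ctx2 coeff]) auto
  have R: "bounded_linear R"
    unfolding R_def by (rule bounded_linear_compose[OF G Ci])
  have R_comm: "L (R x) = R (L x)" if L: "bounded_linear L" "\<And>x. L (X x) = X (L x)" "\<And>x. L (Y x) = Y (L x)" for L x
  proof -
    have "L (Ci x) = Ci (L x)" for x by (rule Ci_comm) (rule C_comm[OF L])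
    then show ?thesis
      unfolding R_def using G_comm[OF L(1)] D_comm[OF L] by (simp add: Z_def)
  qed
  have w_eq: "t *\<^sub>R X (w y t) + (1 - t) *\<^sub>R Y (w y t) = y" if t: "t \<in> {0..1}" for y t
  proof -
    have "w y t = Ci y + (1 - 2 * t) *\<^sub>R Z (w y t)"
      unfolding w_def by (rule op_series_geometric[OF ctx]) (use t in auto)
    then have "C (w y t) = C (Ci y + (1 - 2 * t) *\<^sub>R Z (w y t))" by simp
    also have "\<dots> = y + (1 - 2 * t) *\<^sub>R D (w y t)"
      by (simp add: linear_add[OF linC] linear_scale[OF linC] C_Ci Z_def)
    finally have "C (w y t) - (1 - 2 * t) *\<^sub>R D (w y t) = y" by simp
    moreover have "C (w y t) - (1 - 2 * t) *\<^sub>R D (w y t) = t *\<^sub>R X (w y t) + (1 - t) *\<^sub>R Y (w y t)"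
      by (simp add: C_def D_def algebra_simps flip: scaleR_add_left)
    ultimately show ?thesis by simp
  qed
  have w_cont: "continuous_on {0..1} (w y)" for y
    unfolding w_def using u by (intro continuous_on_op_series[OF ctx] continuous_intros)
  have w_int: "has_bochner_integral arcsine_measure (\<lambda>t. inner (w y t) z) (inner (R y) z)" for y z
  proof -
    \<comment> \<open>Pairing with a fixed \<open>z\<close> leaves a scalar series, which may be
      integrated term by term under a geometric majorant.\<close>
    define c where "c n = inner ((Z ^^ n) (Ci y)) z" for n
    have c_le: "\<bar>c n\<bar> \<le> q ^ n * norm (Ci y) * norm z" for n
      unfolding c_def
      by (rule order_trans[OF Cauchy_Schwarz_ineq2 mult_right_mono[OF norm_funpow_le[OF Z_le q(1)]]]) simp
    have c_sum: "summable (\<lambda>n. q ^ n * norm (Ci y) * norm z)"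
      by (intro summable_mult2 summable_power_mult[OF ctx])
    have sums: "(\<lambda>n. (1 - 2 * t) ^ n * c n) sums inner (w y t) z" if "t \<in> {0..1}" for t
      using bounded_linear.sums[OF bounded_linear_inner_left[of z] op_series_sums[where a = "\<lambda>n. (1 - 2 * t) ^ n" and x = "Ci y", OF ctx u[OF that]]]
      by (simp add: w_def c_def)
    have le: "norm ((1 - 2 * t) ^ n * c n) \<le> q ^ n * norm (Ci y) * norm z" if "t \<in> {0..1}" for t n
      using mult_mono[OF u[OF that, of n] c_le[of n]] by (simp add: abs_mult)
    have int: "integrable arcsine_measure (\<lambda>t. (1 - 2 * t) ^ n * c n)" for n
      by (intro integrable_mult_left integrable_arcsine_measure_power)
    have AE: "AE t in arcsine_measure. summable (\<lambda>n. norm ((1 - 2 * t) ^ n * c n))"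
      by (rule AE_I2, rule summable_comparison_test'[OF c_sum]) (use le in auto)
    have sI: "summable (\<lambda>n. \<integral>t. norm ((1 - 2 * t) ^ n * c n) \<partial>arcsine_measure)"
    proof (rule summable_comparison_test'[OF c_sum])
      fix n
      have "(\<integral>t. norm ((1 - 2 * t) ^ n * c n) \<partial>arcsine_measure) \<le>
          (\<integral>t. q ^ n * norm (Ci y) * norm z \<partial>arcsine_measure)"
        using le by (intro integral_mono_AE integrable_norm int AE_I2) auto
      also have "\<dots> = q ^ n * norm (Ci y) * norm z"
        using prob_arcsine_measure by (simp add: measure_def)
      finally show "norm (\<integral>t. norm ((1 - 2 * t) ^ n * c n) \<partial>arcsine_measure) \<le> q ^ n * norm (Ci y) * norm z"
        by simp
    qed
    have "(\<lambda>n. arcsine_moment n * c n) sums (\<integral>t. (\<Sum>n. (1 - 2 * t) ^ n * c n) \<partial>arcsine_measure)"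
      using sums_integral[OF int AE sI] by (simp add: integral_arcsine_measure_power)
    \<comment> \<open>Only even indices contribute; reindexing by \<open>2 * k\<close> matches the
      series of \<open>G\<close> in Z^2.\<close>
    then have "(\<lambda>k. arcsine_moment (2 * k) * c (2 * k)) sums
        (\<integral>t. (\<Sum>n. (1 - 2 * t) ^ n * c n) \<partial>arcsine_measure)"
      by (subst sums_mono_reindex[where g = "\<lambda>k. 2 * k"])
        (auto simp: strict_mono_def arcsine_moment_def elim!: evenE)
    moreover have pow: "(Z \<circ> Z) ^^ k = Z ^^ (2 * k)" for k
      by (induction k) (auto simp: comp_assoc)
    have "(\<lambda>k. sqrt_coeff k *\<^sub>R ((Z \<circ> Z) ^^ k) (Ci y)) sums G (Ci y)"
      unfolding G_def by (rule op_series_sums[OF ctx2 coeff])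
    from bounded_linear.sums[OF bounded_linear_inner_left[of z] this]
    have "(\<lambda>k. arcsine_moment (2 * k) * c (2 * k)) sums inner (R y) z"
      by (simp add: R_def arcsine_moment_def c_def pow)
    ultimately have "(\<integral>t. (\<Sum>n. (1 - 2 * t) ^ n * c n) \<partial>arcsine_measure) = inner (R y) z"
      by (rule sums_unique2)
    moreover have "integrable arcsine_measure (\<lambda>t. \<Sum>n. (1 - 2 * t) ^ n * c n)"
      by (rule integrable_suminf[OF int AE sI])
    ultimately have "has_bochner_integral arcsine_measure (\<lambda>t. \<Sum>n. (1 - 2 * t) ^ n * c n) (inner (R y) z)"
      by (simp add: has_bochner_integral_iff)
    then show ?thesis
      by (subst has_bochner_integral_cong[OF refl _ refl, where g = "\<lambda>t. \<Sum>n. (1 - 2 * t) ^ n * c n"])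
        (use sums in \<open>auto simp: sums_iff\<close>)
  qed
  have R_sym: "inner (R x) y = inner x (R y)" for x y
  proof -
    have "inner (w x t) y = inner (w y t) x" if "t \<in> {0..1}" for t
    proof -
      \<comment> \<open>The symmetric operator t X + (1 - t) Y is moved across; by
        \<open>w_eq\<close> it turns \<open>w y t\<close> into \<open>y\<close> and
        \<open>w x t\<close> into \<open>x\<close>.\<close>
      have "inner (w x t) (t *\<^sub>R X (w y t) + (1 - t) *\<^sub>R Y (w y t)) =
          inner (w y t) (t *\<^sub>R X (w x t) + (1 - t) *\<^sub>R Y (w x t))"
        by (simp add: inner_add_right coercive_opD(2)[OF X, of "w x t", symmetric]
            coercive_opD(2)[OF Y, of "w x t", symmetric] inner_commute[of "w y t" "X (w x t)"]
            inner_commute[of "w y t" "Y (w x t)"])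
      then show ?thesis by (simp only: w_eq[OF that])
    qed
    then have "has_bochner_integral arcsine_measure (\<lambda>t. inner (w x t) y) (inner (R y) x)"
      by (subst has_bochner_integral_cong[OF refl _ refl, where g = "\<lambda>t. inner (w y t) x"])
        (auto intro: w_int)
    from has_bochner_integral_eq[OF w_int this] show ?thesis by (simp add: inner_commute)
  qed
  have w_nonneg: "0 \<le> inner (w y t) y" if t: "t \<in> {0..1}" for y t
  proof -
    have "0 \<le> t * inner (X (w y t)) (w y t) + (1 - t) * inner (Y (w y t)) (w y t)"
      using t by (intro add_nonneg_nonneg mult_nonneg_nonneg coercive_opD X Y) auto
    also have "\<dots> = inner (t *\<^sub>R X (w y t) + (1 - t) *\<^sub>R Y (w y t)) (w y t)"
      by (simp add: inner_add_left)
    also have "\<dots> = inner (w y t) y" by (simp only: w_eq[OF t] inner_commute)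
    finally show ?thesis .
  qed
  have R_nonneg: "0 \<le> inner (R x) x" for x
  proof -
    have "0 \<le> (\<integral>t. inner (w x t) x \<partial>arcsine_measure)"
      by (intro integral_nonneg_AE AE_I2) (auto intro: w_nonneg)
    then show ?thesis using has_bochner_integral_integral_eq[OF w_int] by metis
  qed
  have R_R: "R (R (X (Y x))) = x" for x
  proof -
    have GG: "G (G p) = p + Z (Z (G (G p)))" for p
    proof -
      have "G (G p) = op_series (\<lambda>n. \<Sum>k\<le>n. sqrt_coeff k * sqrt_coeff (n - k)) (Z \<circ> Z) p"
        unfolding G_def by (rule op_series_mult[OF ctx2 coeff coeff])
      \<comment> \<open>The constant coefficients 1 are written \<open>1 ^ n\<close>, so that
        \<open>op_series_geometric\<close> at \<open>u = 1\<close> gives G^2 = (1 -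
        Z^2)^(-1).\<close>
      then have eq: "G (G p) = op_series (\<lambda>n. 1 ^ n) (Z \<circ> Z) p"
        by (simp add: sqrt_coeff_convolution)
      have "op_series (\<lambda>n. 1 ^ n) (Z \<circ> Z) p =
          p + 1 *\<^sub>R (Z \<circ> Z) (op_series (\<lambda>n. 1 ^ n) (Z \<circ> Z) p)"
        by (rule op_series_geometric[OF ctx2]) simp
      then show ?thesis
        unfolding eq[symmetric] by simp
    qed
    have Z_G: "Z (G p) = G (Z p)" for p by (rule G_comm[OF Z refl])
    have Ci_G: "Ci (G p) = G (Ci p)" for p
      by (rule G_comm[OF Ci]) (simp add: Z_def D_Ci)
    \<comment> \<open>Since X and Y commute, XY = (C + D)(C - D) = C^2 - D^2.\<close>
    have "X (Y x) = C (C x) - D (D x)"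
      by (simp add: C_def D_def linear_add[OF linX] linear_add[OF linY] linear_diff[OF linX]
          linear_diff[OF linY] linear_scale[OF linX] linear_scale[OF linY] comm algebra_simps
          flip: scaleR_add_left)
    then have "Ci (Ci (X (Y x))) = x - Z (Z x)"
      by (simp add: linear_diff[OF bounded_linear.linear[OF Ci]] Ci_C Z_def D_Ci)
    then have "R (R (X (Y x))) = G (G (x - Z (Z x)))"
      by (simp add: R_def Ci_G)
    also have "\<dots> = G (G x) - Z (Z (G (G x)))"
      by (simp add: linear_diff[OF bounded_linear.linear[OF G]] Z_G)
    also have "\<dots> = x" using GG[of x] by (simp add: algebra_simps)
    finally show ?thesis .
  qed
  show ?thesis
    by (rule that[OF R R_sym R_nonneg R_R R_comm w_cont w_eq w_nonneg w_int])
qed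

section \<open>Integrals of continuous Hilbert-space valued functions\<close>

lemma strongly_measurable_compose:
  assumes "strongly_measurable M f" "continuous_on UNIV \<phi>"
  shows "strongly_measurable M (\<lambda>x. \<phi> (f x))"
proof -
  from assms(1) obtain s where "\<And>i::nat. simple_function M (s i)"
    "\<And>x. x \<in> space M \<Longrightarrow> (\<lambda>i. s i x) \<longlonglongrightarrow> f x"
    unfolding strongly_measurable_def by blast
  then show ?thesis
    unfolding strongly_measurable_def
    by (intro exI[of _ "\<lambda>i x. \<phi> (s i x)"])
      (auto intro: simple_function_compose1 continuous_on_tendsto_compose[OF assms(2)])
qed

text \<open>Rounding down stays inside [0, 1] and takes finitely many values there. The mesh 1 / (i
  + 1) makes sense at \<open>i = 0\<close> too.\<close>

definition grid_step :: "nat \<Rightarrow> real \<Rightarrow> real" where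
  "grid_step i t = of_int \<lfloor>real (Suc i) * t\<rfloor> / Suc i"

lemma grid_step_mem: "t \<in> {0..1} \<Longrightarrow> grid_step i t \<in> {0..1}"
proof -
  assume t: "t \<in> {0..1}"
  have "real_of_int \<lfloor>real (Suc i) * t\<rfloor> \<le> real (Suc i) * t" by simp
  also have "\<dots> \<le> real (Suc i) * 1" using t by (intro mult_left_mono) auto
  finally show ?thesis using t by (simp add: grid_step_def)
qed

lemma dist_grid_step: "dist (grid_step i t) t \<le> inverse (Suc i)"
proof -
  have "t - grid_step i t = (real (Suc i) * t - of_int \<lfloor>real (Suc i) * t\<rfloor>) / Suc i"
    by (simp add: grid_step_def diff_divide_distrib del: of_nat_Suc)
  moreover have "0 \<le> real (Suc i) * t - of_int \<lfloor>real (Suc i) * t\<rfloor>"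
    "real (Suc i) * t - of_int \<lfloor>real (Suc i) * t\<rfloor> \<le> 1"
    by linarith+
  ultimately have "0 \<le> t - grid_step i t" "t - grid_step i t \<le> 1 / Suc i"
    by (auto intro!: divide_right_mono simp del: of_nat_Suc)
  then show ?thesis by (simp add: dist_real_def inverse_eq_divide del: of_nat_Suc)
qed

text \<open>On [0, 1] the rounded argument has finite range, so no condition on \<open>f\<close>
  arises.\<close>

lemma simple_function_grid_step: "simple_function arcsine_measure (\<lambda>t. f (grid_step i t))"
proof (rule simple_function_compose1[of _ "grid_step i" f])
  show "simple_function arcsine_measure (grid_step i)"
  proof (rule simple_function_borel_measurable)
    show "grid_step i \<in> borel_measurable arcsine_measure"
      by (rule borel_measurable_arcsine_measure) (unfold grid_step_def, measurable)
    have "\<lfloor>real (Suc i) * t\<rfloor> \<in> {0..int (Suc i)}" if "t \<in> {0..1}" for t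
    proof -
      have "real (Suc i) * t \<le> real (Suc i) * 1" using that by (intro mult_left_mono) auto
      then have "\<lfloor>real (Suc i) * t\<rfloor> \<le> \<lfloor>real (Suc i) * 1\<rfloor>" by (rule floor_mono)
      moreover have "0 \<le> \<lfloor>real (Suc i) * t\<rfloor>" using that by simp
      ultimately show ?thesis by (simp del: of_nat_Suc)
    qed
    then have "grid_step i ` space arcsine_measure \<subseteq> (\<lambda>k. of_int k / Suc i) ` {0..int (Suc i)}"
      by (force simp: grid_step_def)
    then show "finite (grid_step i ` space arcsine_measure)" by (rule finite_subset) simp
  qed
qed

lemma grid_step_uniform:
  fixes f :: "real \<Rightarrow> 'a::metric_space"
  assumes "continuous_on {0..1} f" "0 < e"
  shows "\<forall>\<^sub>F i in sequentially. \<forall>t\<in>{0..1}. dist (f (grid_step i t)) (f t) < e"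
proof -
  have "uniformly_continuous_on {0..1} f"
    using assms(1) by (intro compact_uniformly_continuous) auto
  then obtain d where d: "0 < d"
    "\<And>s t. s \<in> {0..1} \<Longrightarrow> t \<in> {0..1} \<Longrightarrow> dist s t < d \<Longrightarrow> dist (f s) (f t) < e"
    using assms(2) unfolding uniformly_continuous_on_def by metis
  have "\<forall>\<^sub>F i in sequentially. inverse (real (Suc i)) < d"
    using order_tendstoD(2)[OF LIMSEQ_inverse_real_of_nat d(1)] .
  then show ?thesis
  proof eventually_elim
    case (elim i)
    then show ?case
      using d(2) grid_step_mem dist_grid_step[of i] by (meson order.strict_trans1)
  qed
qed

text \<open>The grid approximations are simple and converge by uniform continuity; separability of
  the target does not enter.\<close>

lemma strongly_measurable_arcsine_continuous:
  fixes f :: "real \<Rightarrow> 'a::metric_space"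
  assumes "continuous_on {0..1} f"
  shows "strongly_measurable arcsine_measure f"
  unfolding strongly_measurable_def
proof (intro exI[of _ "\<lambda>i t. f (grid_step i t)"] conjI allI ballI simple_function_grid_step)
  fix t assume "t \<in> space arcsine_measure"
  then show "(\<lambda>i. f (grid_step i t)) \<longlonglongrightarrow> f t"
    using eventually_mono[OF grid_step_uniform[OF assms]] by (fastforce intro!: tendstoI)
qed

text \<open>The simple integrals converge in norm because, with \<open>z\<close> the difference between such an
  integral and \<open>v\<close>, the scalar \<open>inner z z\<close> is an integral of \<open>inner (f (grid_step i t) - f t) z\<close>.\<close>

lemma has_strong_integral_arcsine_continuous:
  fixes f :: "real \<Rightarrow> 'a::real_inner"
  assumes f: "continuous_on {0..1} f"
    and v: "\<And>z. has_bochner_integral arcsine_measure (\<lambda>t. inner (f t) z) (inner v z)"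
  shows "has_strong_integral arcsine_measure f v"
proof -
  let ?s = "\<lambda>i t. f (grid_step i t)"
  let ?I = "\<lambda>i. Bochner_Integration.simple_bochner_integral arcsine_measure (?s i)"
  have s: "Bochner_Integration.simple_bochner_integrable arcsine_measure (?s i)" for i
    by (intro simple_bochner_integrable.intros simple_function_grid_step)
      (simp add: arcsine_measure.emeasure_finite)
  have "(\<lambda>i. \<integral>\<^sup>+t. ennreal (norm (f t - ?s i t)) \<partial>arcsine_measure) \<longlonglongrightarrow> 0"
  proof (rule order_tendstoI)
    fix a :: ennreal assume "0 < a"
    then obtain b where b: "0 < b" "b < a" using dense by blast
    then obtain e where e: "0 \<le> e" "b = ennreal e" by (cases b) auto
    with b have "0 < e" by auto
    show "\<forall>\<^sub>F i in sequentially. (\<integral>\<^sup>+t. ennreal (norm (f t - ?s i t)) \<partial>arcsine_measure) < a"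
      using grid_step_uniform[OF f \<open>0 < e\<close>]
    proof eventually_elim
      case (elim i)
      have "(\<integral>\<^sup>+t. ennreal (norm (f t - ?s i t)) \<partial>arcsine_measure) \<le> (\<integral>\<^sup>+t. ennreal e \<partial>arcsine_measure)"
        using elim by (intro nn_integral_mono ennreal_leI) (auto simp: dist_norm norm_minus_commute less_imp_le)
      also have "\<dots> = b" using prob_arcsine_measure e by simp
      finally show ?case using b(2) by (rule le_less_trans)
    qed
  qed simp
  moreover have "?I \<longlonglongrightarrow> v"
  proof (rule tendstoI)
    fix e :: real assume "0 < e"
    then have "0 < e / 2" by simp
    show "\<forall>\<^sub>F i in sequentially. dist (?I i) v < e"
      using grid_step_uniform[OF f \<open>0 < e / 2\<close>]
    proof eventually_elim
      case (elim i)
      define z where "z = ?I i - v"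
      have "Bochner_Integration.simple_bochner_integrable arcsine_measure (\<lambda>t. inner (?s i t) z)"
        using simple_bochner_integrable_compose2[of "\<lambda>x y. inner x z", OF _ s s] by simp
      from has_bochner_integral_simple_bochner_integrable[OF this]
      have "has_bochner_integral arcsine_measure (\<lambda>t. inner (?s i t) z) (inner (?I i) z)"
        using simple_bochner_integral_linear[OF bounded_linear.linear[OF bounded_linear_inner_left] s]
        by simp
      from has_bochner_integral_diff[OF this v]
      have hz: "has_bochner_integral arcsine_measure (\<lambda>t. inner (?s i t - f t) z) (inner z z)"
        by (simp add: z_def inner_diff_left)
      have "inner z z = (\<integral>t. inner (?s i t - f t) z \<partial>arcsine_measure)"
        using has_bochner_integral_integral_eq[OF hz] by simp
      also have "\<dots> \<le> (\<integral>t. e / 2 * norm z \<partial>arcsine_measure)"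
      proof (rule integral_mono_AE)
        show "integrable arcsine_measure (\<lambda>t. inner (?s i t - f t) z)"
          using hz by (simp add: has_bochner_integral_iff)
        show "AE t in arcsine_measure. inner (?s i t - f t) z \<le> e / 2 * norm z"
        proof (rule AE_I2)
          fix t assume "t \<in> space arcsine_measure"
          then have "norm (?s i t - f t) \<le> e / 2" using elim by (auto simp: dist_norm less_imp_le)
          then show "inner (?s i t - f t) z \<le> e / 2 * norm z"
            by (rule order_trans[OF norm_cauchy_schwarz mult_right_mono]) simp
        qed
      qed simp
      also have "\<dots> = e / 2 * norm z" using prob_arcsine_measure by (simp add: measure_def)
      finally have "norm z * norm z \<le> e / 2 * norm z" by (simp add: dot_square_norm power2_eq_square)
      then have "norm z \<le> e / 2" using \<open>0 < e\<close> by (cases "z = 0") auto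
      then show ?case using \<open>0 < e\<close> by (simp add: z_def dist_norm)
    qed
  qed
  ultimately show ?thesis
    unfolding has_strong_integral_def
    using s strongly_measurable_arcsine_continuous[OF f] by (intro conjI exI[of _ ?s]) auto
qed

text \<open>Pairing the simple approximants with \<open>z\<close> multiplies the L1 error by at most
  \<open>norm z\<close>.\<close>

lemma has_strong_integral_inner:
  fixes f :: "'b \<Rightarrow> 'a::real_inner"
  assumes "has_strong_integral M f v"
  shows "has_bochner_integral M (\<lambda>x. inner (f x) z) (inner v z)"
proof -
  from assms obtain s where f: "strongly_measurable M f"
    and s: "\<And>i::nat. Bochner_Integration.simple_bochner_integrable M (s i)"
    and lim: "(\<lambda>i. \<integral>\<^sup>+x. ennreal (norm (f x - s i x)) \<partial>M) \<longlonglongrightarrow> 0"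
    and v: "(\<lambda>i. Bochner_Integration.simple_bochner_integral M (s i)) \<longlonglongrightarrow> v"
    unfolding has_strong_integral_def by blast
  from f obtain r where r: "\<And>j::nat. simple_function M (r j)"
    "\<And>x. x \<in> space M \<Longrightarrow> (\<lambda>j. r j x) \<longlonglongrightarrow> f x"
    unfolding strongly_measurable_def by blast
  have sf: "simple_function M (s i)" for i
    using s[of i] by cases
  have meas: "(\<lambda>x. norm (f x - s i x)) \<in> borel_measurable M" for i
  \<comment> \<open>The target may be nonseparable, so measurability comes from a limit of real
    simple functions.\<close>
  proof (rule borel_measurable_LIMSEQ_real)
    show "(\<lambda>x. norm (r j x - s i x)) \<in> borel_measurable M" for j
      by (rule borel_measurable_simple_function)
        (rule simple_function_compose2[where h = "\<lambda>a b. norm (a - b)", OF r(1) sf])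
    show "(\<lambda>j. norm (r j x - s i x)) \<longlonglongrightarrow> norm (f x - s i x)" if "x \<in> space M" for x
      by (intro tendsto_intros r(2) that)
  qed
  show ?thesis
  proof (rule has_bochner_integral.intros)
    have "strongly_measurable M (\<lambda>x. inner (f x) z)"
      by (rule strongly_measurable_compose[OF f]) (intro continuous_intros)
    then show "(\<lambda>x. inner (f x) z) \<in> borel_measurable M"
      by (simp add: strongly_measurable_iff_borel_measurable)
    show "Bochner_Integration.simple_bochner_integrable M (\<lambda>x. inner (s i x) z)" for i
      using simple_bochner_integrable_compose2[of "\<lambda>x y. inner x z", OF _ s s] by simp
    show "(\<lambda>i. \<integral>\<^sup>+x. norm (inner (f x) z - inner (s i x) z) \<partial>M) \<longlonglongrightarrow> 0"
    proof (rule tendsto_sandwich[OF _ _ tendsto_const])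
      show "(\<lambda>i. ennreal (norm z) * (\<integral>\<^sup>+x. ennreal (norm (f x - s i x)) \<partial>M)) \<longlonglongrightarrow> 0"
        using ennreal_tendsto_cmult[OF _ lim, of "ennreal (norm z)"] by simp
      have "(\<integral>\<^sup>+x. norm (inner (f x) z - inner (s i x) z) \<partial>M) \<le>
          (\<integral>\<^sup>+x. ennreal (norm z) * ennreal (norm (f x - s i x)) \<partial>M)" for i
      proof (rule nn_integral_mono)
        fix x
        have "\<bar>inner (f x) z - inner (s i x) z\<bar> \<le> norm z * norm (f x - s i x)"
          using Cauchy_Schwarz_ineq2[of "f x - s i x" z] by (simp add: inner_diff_left mult.commute)
        then show "ennreal (norm (inner (f x) z - inner (s i x) z)) \<le> ennreal (norm z) * ennreal (norm (f x - s i x))"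
          by (simp add: ennreal_mult[symmetric] ennreal_leI)
      qed
      then show "\<forall>\<^sub>F i in sequentially. (\<integral>\<^sup>+x. norm (inner (f x) z - inner (s i x) z) \<partial>M) \<le>
          ennreal (norm z) * (\<integral>\<^sup>+x. ennreal (norm (f x - s i x)) \<partial>M)"
        using meas by (simp add: nn_integral_cmult)
    qed simp
    show "(\<lambda>i. Bochner_Integration.simple_bochner_integral M (\<lambda>x. inner (s i x) z)) \<longlonglongrightarrow> inner v z"
      using tendsto_inner[OF v tendsto_const, of z]
        simple_bochner_integral_linear[OF bounded_linear.linear[OF bounded_linear_inner_left] s]
      by simp
  qed
qed

section \<open>Square roots\<close>

lemma coercive_op_bounded_below:
  assumes "coercive_op T"
  obtains c where "0 < c" "\<And>x. c * norm x \<le> norm (T x)"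
proof -
  obtain m where m: "0 < m" "\<And>x. m * (norm x)\<^sup>2 \<le> inner (T x) x"
    by (rule coercive_opE[OF assms]) blast
  have "m * norm x \<le> norm (T x)" for x
  proof (cases "x = 0")
    case False
    have "m * norm x * norm x \<le> norm (T x) * norm x"
      using m(2)[of x] norm_cauchy_schwarz[of "T x" x] by (simp add: power2_eq_square mult.assoc)
    then show ?thesis using False by simp
  qed simp
  with m(1) show ?thesis by (rule that)
qed

text \<open>If \<open>K\<close> bounds \<open>S\<close>, then c |x| \<le> |S (S x)| \<le> K |S x|,
  so \<open>S\<close> is bounded below.\<close>

lemma coercive_op_of_square:
  assumes S: "bounded_linear S" "\<And>x y. inner (S x) y = inner x (S y)" "\<And>x. 0 \<le> inner (S x) x"
    and SS: "\<And>x. S (S x) = T x" and T: "coercive_op T"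
  shows "coercive_op S"
proof -
  obtain c where c: "0 < c" "\<And>x. c * norm x \<le> norm (T x)"
    by (rule coercive_op_bounded_below[OF T]) blast
  obtain K where K: "0 < K" "\<And>x. norm (S x) \<le> norm x * K"
    using bounded_linear.pos_bounded[OF S(1)] by blast
  show ?thesis
  proof (rule coercive_op_of_bounded_below[OF S])
    show "0 < c / K" using c K by simp
    show "c / K * norm x \<le> norm (S x)" for x
      using order_trans[OF c(2)[of x], of "norm (S x) * K"] K(2)[of "S x"] K(1)
      by (simp add: SS field_simps)
  qed
qed

text \<open>The arcsine mean of \<open>T\<close> and the identity is T^(-1/2), so \<open>T\<close>
  times it is the root and inherits its commutation.\<close>

lemma coercive_op_sqrt:
  fixes T :: "'a::{real_inner,banach} \<Rightarrow> 'a"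
  assumes T: "coercive_op T"
  obtains S where "coercive_op S" "\<And>x. S (S x) = T x"
    "\<And>L x. bounded_linear L \<Longrightarrow> (\<And>x. L (T x) = T (L x)) \<Longrightarrow> L (S x) = S (L x)"
proof -
  obtain m where m: "0 < m" "\<And>x. m * (norm x)\<^sup>2 \<le> inner (T x) x"
    by (rule coercive_opE[OF T]) blast
  obtain R where R: "bounded_linear R" "\<And>x y. inner (R x) y = inner x (R y)" "\<And>x. 0 \<le> inner (R x) x"
    and RRT: "\<And>x. R (R (T x)) = x"
    and comm: "\<And>L x. bounded_linear L \<Longrightarrow> (\<And>x. L (T x) = T (L x)) \<Longrightarrow> L (R x) = R (L x)"
    by (rule arcsine_mean_exists[OF T coercive_op_ident refl m]) blast
  define S where "S x = T (R x)" for x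
  have TR: "T (R x) = R (T x)" for x
    by (rule comm) (auto simp: coercive_opD(1)[OF T])
  have SS: "S (S x) = T x" for x by (simp add: S_def TR RRT)
  have S: "coercive_op S"
  proof (rule coercive_op_of_square[OF _ _ _ SS T])
    show "bounded_linear S"
      unfolding S_def by (rule bounded_linear_compose[OF coercive_opD(1)[OF T] R(1)])
    show "inner (S x) y = inner x (S y)" for x y
      by (simp add: S_def coercive_opD(2)[OF T] R(2) TR)
    show "0 \<le> inner (S x) x" for x
    proof -
      have "x = R (R (T x))" "S x = R (T x)" by (simp_all add: RRT S_def TR)
      then show ?thesis using R(3)[of "R (T x)"] by (metis inner_commute)
    qed
  qed
  have "L (S x) = S (L x)" if "bounded_linear L" "\<And>x. L (T x) = T (L x)" for L x
    by (simp add: S_def comm[OF that] that(2))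
  from that[OF S SS this] show ?thesis by blast
qed

text \<open>The root \<open>q\<close> of \<open>Q\<close> commutes with \<open>P\<close>, hence (P Q
  x, x) = (P q x, q x) \<ge> m |q x|^2 = m (Q x, x).\<close>

lemma coercive_op_mult:
  fixes P Q :: "'a::{real_inner,banach} \<Rightarrow> 'a"
  assumes P: "coercive_op P" and Q: "coercive_op Q" and comm: "\<And>x. P (Q x) = Q (P x)"
  shows "coercive_op (\<lambda>x. P (Q x))"
proof -
  obtain q where q: "coercive_op q" "\<And>x. q (q x) = Q x"
    and q_comm: "\<And>L x. bounded_linear L \<Longrightarrow> (\<And>x. L (Q x) = Q (L x)) \<Longrightarrow> L (q x) = q (L x)"
    by (rule coercive_op_sqrt[OF Q]) blast
  obtain m n where mn: "0 < m" "\<And>x. m * (norm x)\<^sup>2 \<le> inner (P x) x"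
    "0 < n" "\<And>x. n * (norm x)\<^sup>2 \<le> inner (Q x) x"
    using coercive_opE[OF P] coercive_opE[OF Q] by metis
  have "m * n * (norm x)\<^sup>2 \<le> inner (P (Q x)) x" for x
  proof -
    have "m * (n * (norm x)\<^sup>2) \<le> m * inner (Q x) x"
      using mn by (intro mult_left_mono) auto
    also have "\<dots> = m * (norm (q x))\<^sup>2"
      using coercive_opD(2)[OF q(1), of "q x" x] by (simp add: power2_norm_eq_inner q(2))
    also have "\<dots> \<le> inner (P (q x)) (q x)" by (rule mn(2))
    also have "\<dots> = inner (P (Q x)) x"
      using coercive_opD(2)[OF q(1), of "P (q x)" x] q_comm[OF coercive_opD(1)[OF P] comm, of "q x"]
      by (simp add: q(2))
    finally show ?thesis by (simp add: mult.assoc)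
  qed
  moreover have "inner (P (Q x)) y = inner x (P (Q y))" for x y
    by (simp add: coercive_opD(2)[OF P] coercive_opD(2)[OF Q] comm)
  moreover have "bounded_linear (\<lambda>x. P (Q x))"
    by (rule bounded_linear_compose[OF coercive_opD(1)[OF P] coercive_opD(1)[OF Q]])
  ultimately show ?thesis
    unfolding coercive_op_def using mn by (auto intro!: exI[of _ "m * n"])
qed

text \<open>For \<open>z = S x - S' x\<close> the square identities give \<open>S z + S' z = 0\<close>.\<close>

lemma coercive_op_sqrt_unique:
  assumes S: "coercive_op S" and S': "bounded_linear S'" "\<And>x. 0 \<le> inner (S' x) x"
    and eq: "\<And>x. S (S x) = S' (S' x)" and comm: "\<And>x. S (S' x) = S' (S x)"
  shows "S = S'"
proof
  fix x
  define z where "z = S x - S' x"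
  have "S z + S' z = 0"
    by (simp add: z_def linear_diff[OF bounded_linear.linear[OF coercive_opD(1)[OF S]]]
        linear_diff[OF bounded_linear.linear[OF S'(1)]] eq comm)
  then have "inner (S z) z + inner (S' z) z = 0"
    by (metis inner_add_left inner_zero_left)
  then have "inner (S z) z = 0"
    using coercive_opD(3)[OF S, of z] S'(2)[of z] by linarith
  then have "z = 0" by (rule coercive_op_inner_eq_0D[OF S])
  then show "S x = S' x" by (simp add: z_def)
qed

section \<open>Positive operators on a complex Hilbert space\<close>

instance complex_hilbert_space \<subseteq> banach ..

text \<open>Makes complex scalars admissible as \<open>L\<close> in the commutation statements,
  which then yield complex linearity.\<close>

lemma bounded_linear_scaleC: "bounded_linear ((*\<^sub>C) c :: 'a::complex_hilbert_space \<Rightarrow> 'a)"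
proof (rule bounded_linear_intro)
  fix x y :: 'a and r :: real
  show "c *\<^sub>C (x + y) = c *\<^sub>C x + c *\<^sub>C y" by (rule scaleC_add_right)
  show "c *\<^sub>C (r *\<^sub>R x) = r *\<^sub>R c *\<^sub>C x" by (simp add: scaleR_scaleC scaleC_scaleC mult.commute)
  have "cinner (c *\<^sub>C x) (c *\<^sub>C x) = complex_of_real ((cmod c)\<^sup>2) * cinner x x"
    by (metis cinner_scaleC_left cinner_commute complex_cnj_mult complex_norm_square mult.assoc)
  then have "(norm (c *\<^sub>C x))\<^sup>2 = (cmod c)\<^sup>2 * (norm x)\<^sup>2"
    unfolding power2_norm_eq_inner inner_eq_Re_cinner by (simp del: of_real_power)
  then have "(norm (c *\<^sub>C x))\<^sup>2 = (norm x * cmod c)\<^sup>2" by (simp add: power_mult_distrib)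
  then show "norm (c *\<^sub>C x) \<le> norm x * cmod c" by simp
qed

lemma cinner_add_right: "cinner x (y + z) = cinner x y + cinner x z"
  for x :: "'a::complex_hilbert_space"
  by (metis cinner_add_left cinner_commute complex_cnj_add)

lemma cinner_scaleC_right: "cinner x (c *\<^sub>C y) = cnj c * cinner x y"
  for x :: "'a::complex_hilbert_space"
  by (metis cinner_scaleC_left cinner_commute complex_cnj_mult)

lemma positive_opD:
  assumes "positive_op T"
  shows "bounded_linear T" "T (c *\<^sub>C x) = c *\<^sub>C T x" "0 \<le> inner (T x) x"
  using assms
  by (auto simp: positive_op_def bounded_clinear_def inner_eq_Re_cinner complex_nonneg_Reals_iff)

text \<open>The quadratic form is real at \<open>x + \<i> *\<^sub>C y\<close>.\<close>

lemma positive_op_symmetric: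
  assumes "positive_op T"
  shows "inner (T x) y = inner x (T y)"
proof -
  have im: "Im (cinner (T x) x) = 0" for x
    using assms by (simp add: positive_op_def complex_nonneg_Reals_iff)
  have "T (x + \<i> *\<^sub>C y) = T x + \<i> *\<^sub>C T y"
    by (simp add: linear_add[OF bounded_linear.linear[OF positive_opD(1)[OF assms]]] positive_opD(2)[OF assms])
  then have "Im (cinner (T x + \<i> *\<^sub>C T y) (x + \<i> *\<^sub>C y)) = 0"
    using im[of "x + \<i> *\<^sub>C y"] by simp
  then have "Re (cinner (T x) y) = Re (cinner (T y) x)"
    by (simp add: cinner_add_left cinner_add_right cinner_scaleC_left cinner_scaleC_right im)
  then show ?thesis by (metis inner_commute inner_eq_Re_cinner)
qed

text \<open>Symmetry tested on \<open>x\<close> and \<open>\<i> *\<^sub>C x\<close> shows that the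
  imaginary part of the quadratic form equals its own negative.\<close>

lemma positive_opI:
  assumes "bounded_linear T" "\<And>c x. T (c *\<^sub>C x) = c *\<^sub>C T x" "\<And>x y. inner (T x) y = inner x (T y)"
    "\<And>x. 0 \<le> inner (T x) x"
  shows "positive_op T"
proof -
  have "Im (cinner (T x) x) = 0" for x
  proof -
    have "inner (T x) (\<i> *\<^sub>C x) = inner x (\<i> *\<^sub>C T x)" by (simp add: assms(2,3))
    then have "Im (cinner (T x) x) = Im (cinner x (T x))"
      by (simp add: inner_eq_Re_cinner cinner_scaleC_right)
    moreover have "Im (cinner x (T x)) = - Im (cinner (T x) x)"
      by (subst cinner_commute) simp
    ultimately show ?thesis by simp
  qed
  then show ?thesis
    using assms unfolding positive_op_def bounded_clinear_def
    by (simp add: complex_nonneg_Reals_iff inner_eq_Re_cinner)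
qed

lemma positive_op_imp_coercive_op:
  fixes T :: "'a::complex_hilbert_space \<Rightarrow> 'a"
  assumes T: "positive_op T" "bij T" "bounded_clinear (inv T)"
  shows "coercive_op T"
proof -
  obtain K where K: "0 < K" "\<And>x. norm (inv T x) \<le> norm x * K"
    using bounded_linear.pos_bounded assms(3) unfolding bounded_clinear_def by blast
  show ?thesis
  proof (rule coercive_op_of_bounded_below)
    show "0 < 1 / K" using K by simp
    show "1 / K * norm x \<le> norm (T x)" for x
      using K(2)[of "T x"] K(1) T(2) by (simp add: bij_is_inj field_simps)
  qed (use positive_opD[OF T(1)] positive_op_symmetric[OF T(1)] in auto)
qed

text \<open>Justifies the definite description in \<open>op_sqrt\<close>. Any other positive root
  commutes with its square \<open>T\<close>, hence with the constructed root, and then coincides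
  with it.\<close>

lemma
  fixes T :: "'a::complex_hilbert_space \<Rightarrow> 'a"
  assumes T: "positive_op T" "coercive_op T"
  shows positive_op_sqrt: "positive_op (op_sqrt T)"
    and coercive_op_op_sqrt: "coercive_op (op_sqrt T)"
    and op_sqrt_op_sqrt: "op_sqrt T (op_sqrt T x) = T x"
    and op_sqrt_comm: "bounded_linear L \<Longrightarrow> (\<And>x. L (T x) = T (L x)) \<Longrightarrow> L (op_sqrt T x) = op_sqrt T (L x)"
    and op_sqrt_unique: "positive_op S' \<Longrightarrow> (\<And>x. S' (S' x) = T x) \<Longrightarrow> op_sqrt T = S'"
proof -
  obtain S where S: "coercive_op S" "\<And>x. S (S x) = T x"
    and comm: "\<And>L x. bounded_linear L \<Longrightarrow> (\<And>x. L (T x) = T (L x)) \<Longrightarrow> L (S x) = S (L x)"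
    by (rule coercive_op_sqrt[OF T(2)]) blast
  have pos: "positive_op S"
    by (rule positive_opI) (use comm[OF bounded_linear_scaleC] positive_opD(2)[OF T(1)] coercive_opD[OF S(1)] in auto)
  have uniq: "S = S'" if "positive_op S'" "\<And>x. S' (S' x) = T x" for S'
  proof (rule coercive_op_sqrt_unique[OF S(1) positive_opD(1,3)[OF that(1)]])
    show "S (S x) = S' (S' x)" for x by (simp add: S(2) that(2))
    show "S (S' x) = S' (S x)" for x
      by (rule comm[OF positive_opD(1)[OF that(1)], symmetric]) (simp flip: that(2))
  qed
  have eq: "op_sqrt T = S"
    unfolding op_sqrt_def
  proof (rule the_equality)
    show "positive_op S \<and> S \<circ> S = T" using pos S(2) by auto
    show "S' = S" if "positive_op S' \<and> S' \<circ> S' = T" for S'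
      using uniq[of S'] that by (auto simp: fun_eq_iff)
  qed
  show "positive_op (op_sqrt T)" "coercive_op (op_sqrt T)" "op_sqrt T (op_sqrt T x) = T x"
    using pos S by (simp_all add: eq)
  show "L (op_sqrt T x) = op_sqrt T (L x)" if "bounded_linear L" "\<And>x. L (T x) = T (L x)"
    unfolding eq by (rule comm[OF that])
  show "op_sqrt T = S'" if "positive_op S'" "\<And>x. S' (S' x) = T x"
    unfolding eq by (rule uniq[OF that])
qed

section \<open>The variational formula\<close>

text \<open>The approximants of the integral are kept. Strong measurability needs new ones, since it
  asks for convergence at every point.\<close>

lemma has_strong_integral_null_set:
  fixes f :: "'b \<Rightarrow> 'a::real_normed_vector"
  assumes f: "has_strong_integral M f v" and N: "N \<in> sets M" "AE x in M. x \<notin> N"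
  shows "has_strong_integral M (\<lambda>x. if x \<in> N then 0 else f x) v"
proof -
  from f obtain s where s: "\<And>i::nat. Bochner_Integration.simple_bochner_integrable M (s i)"
    and lim: "(\<lambda>i. \<integral>\<^sup>+x. ennreal (norm (f x - s i x)) \<partial>M) \<longlonglongrightarrow> 0"
    and v: "(\<lambda>i. Bochner_Integration.simple_bochner_integral M (s i)) \<longlonglongrightarrow> v"
    unfolding has_strong_integral_def by blast
  from f obtain r where r: "\<And>j::nat. simple_function M (r j)"
    "\<And>x. x \<in> space M \<Longrightarrow> (\<lambda>j. r j x) \<longlonglongrightarrow> f x"
    unfolding has_strong_integral_def strongly_measurable_def by blast
  have "simple_function M (\<lambda>x. if x \<in> N then 0 else r j x)" for j
    by (rule simple_function_If_set) (use r N sets.Int_space_eq2[of N M] in auto)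
  then have "strongly_measurable M (\<lambda>x. if x \<in> N then 0 else f x)"
    unfolding strongly_measurable_def
    by (intro exI[of _ "\<lambda>j x. if x \<in> N then 0 else r j x"]) (use r in auto)
  moreover have "(\<integral>\<^sup>+x. ennreal (norm ((if x \<in> N then 0 else f x) - s i x)) \<partial>M) =
      (\<integral>\<^sup>+x. ennreal (norm (f x - s i x)) \<partial>M)" for i
    using N(2) by (intro nn_integral_cong_AE) (auto elim: eventually_mono)
  ultimately show ?thesis
    unfolding has_strong_integral_def using s lim v by (intro conjI exI[of _ s]) auto
qed

text \<open>\<open>ennreal\<close> truncates negative values to 0, so the right side integrates the
  positive part.\<close>

lemma integral_le_nn_integral:
  fixes c :: "'b \<Rightarrow> real"
  assumes "integrable M c"
  shows "ennreal (integral\<^sup>L M c) \<le> (\<integral>\<^sup>+x. ennreal (c x) \<partial>M)"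
proof -
  have "ennreal (integral\<^sup>L M c) \<le> ennreal (\<integral>x. max 0 (c x) \<partial>M)"
    using assms by (intro ennreal_leI integral_mono integrable_max) auto
  also have "\<dots> = (\<integral>\<^sup>+x. ennreal (max 0 (c x)) \<partial>M)"
    using assms by (intro nn_integral_eq_integral[symmetric] integrable_max) auto
  also have "\<dots> = (\<integral>\<^sup>+x. ennreal (c x) \<partial>M)"
    by (intro nn_integral_cong) (auto simp: max_def ennreal_neg)
  finally show ?thesis .
qed

lemma coercive_op_inv:
  assumes T: "coercive_op T" and bij: "bij T" and "bounded_linear (inv T)"
  shows "coercive_op (inv T)"
proof -
  have T_inv: "T (inv T x) = x" for x by (rule surj_f_inv_f[OF bij_is_surj[OF bij]])
  obtain K where K: "0 < K" "\<And>x. norm (T x) \<le> norm x * K"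
    using bounded_linear.pos_bounded[OF coercive_opD(1)[OF T]] by blast
  show ?thesis
  proof (rule coercive_op_of_bounded_below)
    show "inner (inv T x) y = inner x (inv T y)" for x y
      using coercive_opD(2)[OF T, of "inv T x" "inv T y"] by (simp add: T_inv)
    show "0 \<le> inner (inv T x) x" for x
      using coercive_opD(3)[OF T, of "inv T x"] by (simp add: T_inv inner_commute)
    show "0 < 1 / K" using K by simp
    show "1 / K * norm x \<le> norm (inv T x)" for x
      using K(2)[of "inv T x"] K(1) by (simp add: T_inv field_simps)
  qed fact
qed

theorem lemma3p3:
  fixes A B :: "'h::complex_hilbert_space \<Rightarrow> 'h" and y :: 'h
  assumes "positive_op A" and "bij A" and "bounded_clinear (inv A)"
    and "positive_op B" and "bij B" and "bounded_clinear (inv B)"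
    and "A \<circ> B = B \<circ> A"
  shows "cinner (op_sqrt (A \<circ> B) y) y \<in> \<real>\<^sub>\<ge>\<^sub>0 \<and>
    ennreal (Re (cinner (op_sqrt (A \<circ> B) y) y)) = (INF (f, g)\<in>admissible A B y. energy A B f g)"
proof -
  have A: "coercive_op A" and B: "coercive_op B"
    using assms by (auto intro: positive_op_imp_coercive_op)
  have AB: "A (B x) = B (A x)" for x
    using assms(7) by (auto simp: fun_eq_iff)
  define X where "X = inv A"
  define Y where "Y = inv B"
  have X: "coercive_op X" and Y: "coercive_op Y"
    using assms A B by (auto simp: X_def Y_def bounded_clinear_def intro: coercive_op_inv)
  have AX: "A (X x) = x" and XA: "X (A x) = x" and BY: "B (Y x) = x" and YB: "Y (B x) = x" for x
    using assms(2,5) by (auto simp: X_def Y_def bij_is_inj bij_is_surj surj_f_inv_f)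
  have X_comm: "L (X x) = X (L x)" if "\<And>x. L (A x) = A (L x)" for L x
    by (metis that AX XA)
  have Y_comm: "L (Y x) = Y (L x)" if "\<And>x. L (B x) = B (L x)" for L x
    by (metis that BY YB)
  have XY: "X (Y x) = Y (X x)" for x
    by (rule Y_comm) (simp add: X_comm[of B, OF AB[symmetric]])
  \<comment> \<open>The product XY is coercive; symmetry of Y rewrites its form as (X x, Y
    x).\<close>
  obtain m where m: "0 < m" "\<And>x. m * (norm x)\<^sup>2 \<le> inner (X x) (Y x)"
    using coercive_opE[OF coercive_op_mult[OF X Y XY]]
    by (metis XY coercive_opD(2)[OF Y] inner_commute)
  obtain R w where R: "bounded_linear R" "\<And>x y. inner (R x) y = inner x (R y)" "\<And>x. 0 \<le> inner (R x) x"
    and RR: "\<And>x. R (R (X (Y x))) = x"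
    and R_comm: "\<And>L x. bounded_linear L \<Longrightarrow> (\<And>x. L (X x) = X (L x)) \<Longrightarrow> (\<And>x. L (Y x) = Y (L x)) \<Longrightarrow>
      L (R x) = R (L x)"
    and w_cont: "\<And>y. continuous_on {0..1} (w y)"
    and w_eq: "\<And>y t. t \<in> {0..1} \<Longrightarrow> t *\<^sub>R X (w y t) + (1 - t) *\<^sub>R Y (w y t) = y"
    and w_nonneg: "\<And>y t. t \<in> {0..1} \<Longrightarrow> 0 \<le> inner (w y t) y"
    and w_int: "\<And>y z. has_bochner_integral arcsine_measure (\<lambda>t. inner (w y t) z) (inner (R y) z)"
    by (rule arcsine_mean_exists[OF X Y XY m]) blast
  define P where "P = op_sqrt A"
  define Q where "Q = op_sqrt B"
  have P: "coercive_op P" "\<And>x. P (P x) = A x" and Q: "coercive_op Q" "\<And>x. Q (Q x) = B x"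
    using assms A B by (simp_all add: P_def Q_def coercive_op_op_sqrt op_sqrt_op_sqrt)
  have pos_P: "positive_op P" and pos_Q: "positive_op Q"
    using assms A B by (simp_all add: P_def Q_def positive_op_sqrt)
  have A_Q: "A (Q x) = Q (A x)" for x
    unfolding Q_def by (rule op_sqrt_comm[OF assms(4) B coercive_opD(1)[OF A] AB])
  have Q_P: "Q (P x) = P (Q x)" for x
    unfolding P_def by (rule op_sqrt_comm[OF assms(1) A coercive_opD(1)[OF Q(1)] A_Q[symmetric]])
  have P_X: "P (X x) = X (P x)" for x
    by (rule X_comm) (simp flip: P(2))

  have AB_coercive: "coercive_op (A \<circ> B)"
    using coercive_op_mult[OF A B AB] by (simp add: comp_def)
  have AB_pos: "positive_op (A \<circ> B)"
    by (rule positive_opI)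
      (use coercive_opD[OF AB_coercive] positive_opD(2)[OF assms(1)] positive_opD(2)[OF assms(4)] in auto)
  have scaleC_X: "c *\<^sub>C X x = X (c *\<^sub>C x)" for c x
    by (rule X_comm) (simp add: positive_opD(2)[OF assms(1)])
  have scaleC_Y: "c *\<^sub>C Y x = Y (c *\<^sub>C x)" for c x
    by (rule Y_comm) (simp add: positive_opD(2)[OF assms(4)])
  \<comment> \<open>R^2 inverts XY, hence equals AB; uniqueness of the positive root does the
    rest.\<close>
  have "op_sqrt (A \<circ> B) = R"
  proof (rule op_sqrt_unique[OF AB_pos AB_coercive])
    show "positive_op R"
      by (rule positive_opI) (use R R_comm[OF bounded_linear_scaleC scaleC_X scaleC_Y] in auto)
    show "R (R x) = (A \<circ> B) x" for x
      using RR[of "B (A x)"] by (simp add: YB XA AB)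
  qed
  \<comment> \<open>The factorisation of \<open>R\<close> through \<open>P\<close> and
    \<open>Q\<close> links the constraint, stated with the separate roots, to
    \<open>R y\<close>.\<close>
  moreover have "op_sqrt (A \<circ> B) = (\<lambda>x. P (Q x))"
  proof (rule op_sqrt_unique[OF AB_pos AB_coercive])
    show "positive_op (\<lambda>x. P (Q x))"
      by (rule positive_opI)
        (use coercive_opD[OF coercive_op_mult[OF P(1) Q(1) Q_P[symmetric]]]
          positive_opD(2)[OF pos_P] positive_opD(2)[OF pos_Q] in auto)
    show "P (Q (P (Q x))) = (A \<circ> B) x" for x
      by (simp add: Q_P P(2) Q(2))
  qed
  ultimately have sqrt_AB: "op_sqrt (A \<circ> B) = R" and R_PQ: "R x = P (Q x)" for x
    by auto

  have id_meas: "(\<lambda>t. t) \<in> borel_measurable arcsine_measure"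
    by (rule borel_measurable_arcsine_measure) simp
  have form_meas: "(\<lambda>t. inner (T (f t)) (f t)) \<in> borel_measurable arcsine_measure"
    if "strongly_measurable arcsine_measure f" "coercive_op T" for T and f :: "real \<Rightarrow> 'h"
  proof -
    have "continuous_on UNIV T"
      by (rule linear_continuous_on[OF coercive_opD(1)[OF that(2)]])
    then have "strongly_measurable arcsine_measure (\<lambda>t. inner (T (f t)) (f t))"
      by (intro strongly_measurable_compose[OF that(1), of "\<lambda>x. inner (T x) x"] continuous_intros)
    then show ?thesis by (simp add: strongly_measurable_iff_borel_measurable)
  qed
  have energy_eq: "energy A B f g = (\<integral>\<^sup>+t. ennreal (inner (A (f t)) (f t) / t) +
      ennreal (inner (B (g t)) (g t) / (1 - t)) \<partial>arcsine_measure)"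
    if "strongly_measurable arcsine_measure f" "strongly_measurable arcsine_measure g" for f g
    unfolding energy_def inner_eq_Re_cinner[symmetric]
    using form_meas[OF that(1) A] form_meas[OF that(2) B] id_meas
    by (intro nn_integral_add[symmetric]) auto

  have "ennreal (inner (R y) y) = (INF (f, g)\<in>admissible A B y. energy A B f g)"
  proof (rule antisym)

    \<comment> \<open>Lower bound for every admissible pair\<close>
    show "ennreal (inner (R y) y) \<le> (INF (f, g)\<in>admissible A B y. energy A B f g)"
    proof (rule INF_greatest, clarify)
      fix f g assume "(f, g) \<in> admissible A B y"
      then have meas: "strongly_measurable arcsine_measure f" "strongly_measurable arcsine_measure g"
        and eq: "AE t in arcsine_measure. A (f t) /\<^sub>R t = B (g t) /\<^sub>R (1 - t)"
        and int: "has_strong_integral arcsine_measure (\<lambda>t. P (f t) /\<^sub>R t) (Q y)"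
        by (auto simp: admissible_def P_def Q_def)
      define h where "h t = A (f t) /\<^sub>R t" for t
      \<comment> \<open>Testing the constraint against \<open>P y\<close> supplies the second root
        of \<open>A\<close> and turns the integrand into (h, y).\<close>
      have "has_bochner_integral arcsine_measure (\<lambda>t. inner (P (f t) /\<^sub>R t) (P y)) (inner (Q y) (P y))"
        by (rule has_strong_integral_inner[OF int])
      moreover have "inner (P (f t) /\<^sub>R t) (P y) = inner (h t) y" for t
        by (simp add: h_def coercive_opD(2)[OF P(1), symmetric] P(2)
            linear_scale[OF bounded_linear.linear[OF coercive_opD(1)[OF P(1)]]])
      moreover have "inner (Q y) (P y) = inner (R y) y"
        by (simp add: R_PQ coercive_opD(2)[OF P(1)])
      ultimately have "has_bochner_integral arcsine_measure (\<lambda>t. inner (h t) y) (inner (R y) y)"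
        by simp
      \<comment> \<open>This integrand bounds the energy density from below, and its integral is 2
        (R y, y) - (R y, y).\<close>
      from has_bochner_integral_diff[OF has_bochner_integral_mult_right[OF this, of 2] w_int[of y y]]
      have c: "has_bochner_integral arcsine_measure (\<lambda>t. 2 * inner (h t) y - inner (w y t) y) (inner (R y) y)"
        by simp
      have "ennreal (inner (R y) y) \<le> (\<integral>\<^sup>+t. ennreal (2 * inner (h t) y - inner (w y t) y) \<partial>arcsine_measure)"
        using integral_le_nn_integral[of arcsine_measure "\<lambda>t. 2 * inner (h t) y - inner (w y t) y"] c
        by (simp add: has_bochner_integral_iff)
      also have "\<dots> \<le> energy A B f g"
        unfolding energy_eq[OF meas]
      proof (rule nn_integral_mono_AE)
        show "AE t in arcsine_measure. ennreal (2 * inner (h t) y - inner (w y t) y) \<le>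
            ennreal (inner (A (f t)) (f t) / t) + ennreal (inner (B (g t)) (g t) / (1 - t))"
          using eq AE_arcsine_measure_interior
        proof eventually_elim
          case (elim t)
          then have t: "0 < t" "t < 1" "t \<in> {0..1}" by auto
          define M where "M x = t *\<^sub>R X x + (1 - t) *\<^sub>R Y x" for x
          have M: "coercive_op M"
            unfolding M_def by (rule coercive_op_convex[OF X Y]) (use t in auto)
          have Mw: "M (w y t) = y" unfolding M_def by (rule w_eq[OF t(3)])
          have Af: "A (f t) = t *\<^sub>R h t" using t by (simp add: h_def)
          have Bg: "B (g t) = (1 - t) *\<^sub>R h t" using t elim by (simp add: h_def)
          have f: "f t = t *\<^sub>R X (h t)"
            using XA[of "f t"] by (simp add: Af linear_scale[OF bounded_linear.linear[OF coercive_opD(1)[OF X]]])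
          have g: "g t = (1 - t) *\<^sub>R Y (h t)"
            using YB[of "g t"] by (simp add: Bg linear_scale[OF bounded_linear.linear[OF coercive_opD(1)[OF Y]]])
          have sum: "inner (A (f t)) (f t) / t + inner (B (g t)) (g t) / (1 - t) = inner (h t) (M (h t))"
            unfolding Af Bg M_def inner_add_right f[symmetric] g[symmetric] using t by simp
          have "0 \<le> inner (M (h t - w y t)) (h t - w y t)" by (rule coercive_opD(3)[OF M])
          also have "\<dots> = inner (h t) (M (h t)) - 2 * inner (h t) y + inner (w y t) y"
            using coercive_opD(2)[OF M, of "h t" "w y t"]
            by (simp add: linear_diff[OF bounded_linear.linear[OF coercive_opD(1)[OF M]]] Mw
                inner_diff_left inner_diff_right inner_commute[of y] inner_commute[of "M (h t)" "h t"])
          finally have "2 * inner (h t) y - inner (w y t) y \<le>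
              inner (A (f t)) (f t) / t + inner (B (g t)) (g t) / (1 - t)"
            unfolding sum by simp
          then show ?case
            using t coercive_opD(3)[OF A, of "f t"] coercive_opD(3)[OF B, of "g t"]
            by (simp add: ennreal_plus[symmetric] ennreal_leI del: ennreal_plus)
        qed
      qed
      finally show "ennreal (inner (R y) y) \<le> energy A B f g" .
    qed
  next

    \<comment> \<open>The minimising pair\<close>
    define f where "f t = t *\<^sub>R X (w y t)" for t
    define g where "g t = (1 - t) *\<^sub>R Y (w y t)" for t
    have Xw: "continuous_on {0..1} (\<lambda>t. X (w y t))" and Yw: "continuous_on {0..1} (\<lambda>t. Y (w y t))"
      using w_cont bounded_linear.continuous_on[OF coercive_opD(1)] X Y by blast+
    have meas: "strongly_measurable arcsine_measure f" "strongly_measurable arcsine_measure g"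
      unfolding f_def g_def
      by (intro strongly_measurable_arcsine_continuous continuous_intros Xw Yw)+
    have Af: "A (f t) = t *\<^sub>R w y t" for t
      by (simp add: f_def linear_scale[OF bounded_linear.linear[OF coercive_opD(1)[OF A]]] AX)
    have Bg: "B (g t) = (1 - t) *\<^sub>R w y t" for t
      by (simp add: g_def linear_scale[OF bounded_linear.linear[OF coercive_opD(1)[OF B]]] BY)
    have "has_strong_integral arcsine_measure (\<lambda>t. P (X (w y t))) (Q y)"
    proof (rule has_strong_integral_arcsine_continuous)
      show "continuous_on {0..1} (\<lambda>t. P (X (w y t)))"
        by (rule bounded_linear.continuous_on[OF coercive_opD(1)[OF P(1)] Xw])
      fix z
      \<comment> \<open>Since R = PQ, P commutes with X and P^2 = A, the operator P X R reduces to
        Q.\<close>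
      have "inner (R y) (X (P z)) = inner (Q y) z"
        using coercive_opD(2)[OF X, of "R y" "P z"] coercive_opD(2)[OF P(1), of "X (R y)" z]
        by (simp add: R_PQ P_X P(2) XA)
      then show "has_bochner_integral arcsine_measure (\<lambda>t. inner (P (X (w y t))) z) (inner (Q y) z)"
        using w_int[of y "X (P z)"]
        by (simp add: coercive_opD(2)[OF P(1)] coercive_opD(2)[OF X])
    qed
    moreover have "{0} \<in> sets arcsine_measure"
      by (auto simp: arcsine_measure_def sets_restrict_space intro!: image_eqI[of _ _ "{0}"])
    moreover have "AE t in arcsine_measure. t \<notin> {0}"
      using AE_arcsine_measure_interior by eventually_elim auto
    \<comment> \<open>At \<open>t = 0\<close> the quotient \<open>P (f t) /\<^sub>R t\<close> is 0
      by convention, while \<open>P (X (w y t))\<close> need not vanish there.\<close>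
    ultimately have "has_strong_integral arcsine_measure (\<lambda>t. if t \<in> {0} then 0 else P (X (w y t))) (Q y)"
      by (rule has_strong_integral_null_set)
    also have "(\<lambda>t. if t \<in> {0} then 0 else P (X (w y t))) = (\<lambda>t. P (f t) /\<^sub>R t)"
      by (auto simp: f_def linear_scale[OF bounded_linear.linear[OF coercive_opD(1)[OF P(1)]]])
    finally have int: "has_strong_integral arcsine_measure (\<lambda>t. P (f t) /\<^sub>R t) (Q y)" .
    have "AE t in arcsine_measure. A (f t) /\<^sub>R t = B (g t) /\<^sub>R (1 - t)"
      using AE_arcsine_measure_interior by eventually_elim (simp add: Af Bg)
    then have adm: "(f, g) \<in> admissible A B y"
      using meas int by (simp add: admissible_def P_def Q_def)
    have "energy A B f g = (\<integral>\<^sup>+t. ennreal (inner (w y t) y) \<partial>arcsine_measure)"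
      unfolding energy_eq[OF meas]
    proof (rule nn_integral_cong_AE)
      show "AE t in arcsine_measure. ennreal (inner (A (f t)) (f t) / t) +
          ennreal (inner (B (g t)) (g t) / (1 - t)) = ennreal (inner (w y t) y)"
        using AE_arcsine_measure_interior
      proof eventually_elim
        case (elim t)
        then have t: "t \<in> {0..1}" by auto
        \<comment> \<open>The defining equation of \<open>w\<close> says that
          \<open>f t + g t = y\<close>.\<close>
        have "inner (w y t) y = inner (w y t) (f t) + inner (w y t) (g t)"
          by (subst w_eq[OF t, symmetric]) (simp add: f_def g_def inner_add_right)
        also have "\<dots> = inner (A (f t)) (f t) / t + inner (B (g t)) (g t) / (1 - t)"
          using elim by (simp add: Af Bg)
        finally show ?case
          using elim coercive_opD(3)[OF A, of "f t"] coercive_opD(3)[OF B, of "g t"]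
          by (simp add: ennreal_plus)
      qed
    qed
    also have "\<dots> = ennreal (inner (R y) y)"
    proof -
      have "AE t in arcsine_measure. 0 \<le> inner (w y t) y"
        by (rule AE_I2) (simp add: w_nonneg)
      then show ?thesis
        using w_int[of y y] nn_integral_eq_integral[of arcsine_measure "\<lambda>t. inner (w y t) y"]
        by (simp add: has_bochner_integral_iff)
    qed
    finally show "(INF (f, g)\<in>admissible A B y. energy A B f g) \<le> ennreal (inner (R y) y)"
      using INF_lower[OF adm, of "\<lambda>(f, g). energy A B f g"] by simp
  qed
  moreover have "cinner (op_sqrt (A \<circ> B) y) y \<in> \<real>\<^sub>\<ge>\<^sub>0"
    using positive_op_sqrt[OF AB_pos AB_coercive] by (simp add: positive_op_def)
  ultimately show ?thesis
    by (simp add: sqrt_AB inner_eq_Re_cinner)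
qed

end
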